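(* Let $c\ge1$ and $v_0=\sqrt{c^2+|v|^2}$. For any smooth functions $f,h$ on $\mathbb{R}^3$ and any $i,j\in\{1,2,3\}$ with $i\ne j$, $$v_0\partial_{v_j}Q_c(h,f)=Q_c\big(h,\,v_0\partial_{v_j}f\big)+Q_c\big(v_0\partial_{v_j}h,\,f\big)-\frac{v_j}{v_0}Q_c(h,f),$$ and $$(v_j\partial_{v_i}-v_i\partial_{v_j})Q_c(h,f)=Q_c\big(h,\,(v_j\partial_{v_i}-v_i\partial_{v_j})f\big)+Q_c\big((v_j\partial_{v_i}-v_i\partial_{v_j})h,\,f\big).$$
   Context: $c\ge 1$ is the speed of light. For $v\in\mathbb{R}^3$ put $v_0=\sqrt{c^2+|v|^2}$ (similarly $u_0,v_0',u_0'$). The relativistic Boltzmann collision operator is $$Q_c(h,f)(v)=\int_{\mathbb{R}^3}\int_{\mathbb{S}^2}B_c(v,u)\big(h(u')f(v')-h(u)f(v)\big)\,d\omega\,du,$$ where $g=\sqrt{2(v_0u_0-v\cdot u-c^2)}$, $s=2(v_0u_0-v\cdot u+c^2)=g^2+4c^2$, $B_c(v,u)=v_\phi\,\sigma(g,\vartheta)$, $v_\phi=\frac{cg\sqrt s}{4v_0u_0}$, $\sigma(g,\vartheta)=|g|^{\gamma-1}\sigma_0(\vartheta)$ with $\sigma_0$ nonnegative and bounded (the paper works with $\gamma\in(-2,0]$), the post-collisional momenta are $$v'=\frac{v+u}2+\frac g2\left(\omega+(v+u)\frac{(v+u)\cdot\omega}{\sqrt s(v_0+u_0+\sqrt s)}\right),\quad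 u'=\frac{v+u}2-\frac g2\left(\omega+(v+u)\frac{(v+u)\cdot\omega}{\sqrt s(v_0+u_0+\sqrt s)}\right),$$ and $\cos\vartheta=\frac{-(v_0-u_0)(v_0'-u_0')+(v-u)\cdot(v'-u')}{g^2}$. Smooth functions are implicitly taken with enough decay (together with their derivatives) for all integrals to converge. *)

theory Defs
  imports "HOL-Analysis.Analysis"
begin

definition energy :: "real \<Rightarrow> real^3 \<Rightarrow> real" where
  "energy c v = sqrt (c\<^sup>2 + (norm v)\<^sup>2)"

definition rel_g :: "real \<Rightarrow> real^3 \<Rightarrow> real^3 \<Rightarrow> real" where
  "rel_g c v u = sqrt (2 * (energy c v * energy c u - v \<bullet> u - c\<^sup>2))"

definition rel_s :: "real \<Rightarrow> real^3 \<Rightarrow> real^3 \<Rightarrow> real" where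
  "rel_s c v u = 2 * (energy c v * energy c u - v \<bullet> u + c\<^sup>2)"

definition moller_velocity :: "real \<Rightarrow> real^3 \<Rightarrow> real^3 \<Rightarrow> real" where
  "moller_velocity c v u =
     c * rel_g c v u * sqrt (rel_s c v u) / (4 * energy c v * energy c u)"

definition deflection :: "real \<Rightarrow> real^3 \<Rightarrow> real^3 \<Rightarrow> real^3 \<Rightarrow> real^3" where
  "deflection c v u \<omega> = (rel_g c v u / 2) *\<^sub>R
     (\<omega> + (((v + u) \<bullet> \<omega>) /
           (sqrt (rel_s c v u) * (energy c v + energy c u + sqrt (rel_s c v u)))) *\<^sub>R (v + u))"

definition post_v :: "real \<Rightarrow> real^3 \<Rightarrow> real^3 \<Rightarrow> real^3 \<Rightarrow> real^3" where
  "post_v c v u \<omega> = (1/2) *\<^sub>R (v + u) + deflection c v u \<omega>"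

definition post_u :: "real \<Rightarrow> real^3 \<Rightarrow> real^3 \<Rightarrow> real^3 \<Rightarrow> real^3" where
  "post_u c v u \<omega> = (1/2) *\<^sub>R (v + u) - deflection c v u \<omega>"

text \<open>For \<open>u \<noteq> v\<close> the quotient below lies in \<open>{-1..1}\<close>. For \<open>u = v\<close> it is \<open>0/0 = 0\<close>; this
  concerns a null set of \<open>u\<close> only.\<close>

definition cos_scattering_angle :: "real \<Rightarrow> real^3 \<Rightarrow> real^3 \<Rightarrow> real^3 \<Rightarrow> real" where
  "cos_scattering_angle c v u \<omega> =
     (- (energy c v - energy c u) * (energy c (post_v c v u \<omega>) - energy c (post_u c v u \<omega>))
      + (v - u) \<bullet> (post_v c v u \<omega> - post_u c v u \<omega>)) / (rel_g c v u)\<^sup>2"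

definition scattering_angle :: "real \<Rightarrow> real^3 \<Rightarrow> real^3 \<Rightarrow> real^3 \<Rightarrow> real" where
  "scattering_angle c v u \<omega> = arccos (cos_scattering_angle c v u \<omega>)"

definition cross_section :: "real \<Rightarrow> (real \<Rightarrow> real) \<Rightarrow> real \<Rightarrow> real \<Rightarrow> real" where
  "cross_section \<gamma> \<sigma>\<^sub>0 g \<theta> = \<bar>g\<bar> powr (\<gamma> - 1) * \<sigma>\<^sub>0 \<theta>"

definition collision_kernel ::
  "real \<Rightarrow> real \<Rightarrow> (real \<Rightarrow> real) \<Rightarrow> real^3 \<Rightarrow> real^3 \<Rightarrow> real^3 \<Rightarrow> real" where
  "collision_kernel c \<gamma> \<sigma>\<^sub>0 v u \<omega> =
     moller_velocity c v u * cross_section \<gamma> \<sigma>\<^sub>0 (rel_g c v u) (scattering_angle c v u \<omega>)"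

text \<open>Surface measure \<open>d\<omega>\<close> of the unit sphere, as a measure on the ambient space concentrated on
  the sphere: the area of a Borel set \<open>A\<close> of unit vectors is three times the volume of the cone
  \<open>{r *\<^sub>R \<omega> | 0 < r < 1, \<omega> \<in> A}\<close>, by polar coordinates \<open>dx = r\<^sup>2 dr d\<omega>\<close>. Here
  \<open>sgn x = x /\<^sub>R norm x\<close>. The total mass is \<open>4 * pi\<close>.\<close>

definition sphere_measure :: "(real^3) measure" where
  "sphere_measure = distr (density lborel (\<lambda>x. 3 * indicator (ball 0 1) x)) borel sgn"

definition collision_op ::
  "real \<Rightarrow> real \<Rightarrow> (real \<Rightarrow> real) \<Rightarrow> (real^3 \<Rightarrow> real) \<Rightarrow> (real^3 \<Rightarrow> real) \<Rightarrow> real^3 \<Rightarrow> real" where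
  "collision_op c \<gamma> \<sigma>\<^sub>0 h f v =
     (LINT u|lborel. LINT \<omega>|sphere_measure. collision_kernel c \<gamma> \<sigma>\<^sub>0 v u \<omega> *
        (h (post_u c v u \<omega>) * f (post_v c v u \<omega>) - h u * f v))"

definition partial :: "3 \<Rightarrow> (real^3 \<Rightarrow> real) \<Rightarrow> real^3 \<Rightarrow> real" where
  "partial j F v = deriv (\<lambda>t. F (v + t *\<^sub>R axis j 1)) 0"

text \<open>\<open>C\<^sup>\<infinity>\<close>: every iterated partial derivative is (Frechet) differentiable everywhere, hence
  continuous.\<close>

definition smooth :: "(real^3 \<Rightarrow> real) \<Rightarrow> bool" where
  "smooth F \<longleftrightarrow> (\<forall>js. foldr partial js F differentiable_on UNIV)"

text \<open>A decay under which the integrals converge. Write \<open>v0\<close> for \<open>energy c v\<close>, and likewise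
  \<open>u0\<close>, \<open>v0'\<close>, \<open>u0'\<close>. As \<open>v0 = O(1 + |v|)\<close>, it makes \<open>F\<close>,
  \<open>v0 \<partial>\<^sub>j F\<close> and \<open>(v\<^sub>j \<partial>\<^sub>i - v\<^sub>i \<partial>\<^sub>j) F\<close> all \<open>O((1 + |v|) ^ (-3))\<close>.
  By conservation of energy, \<open>v0' + u0' = v0 + u0\<close>, the loss and gain integrands of the collision
  operator are then, for fixed \<open>v\<close> and \<open>-2 < \<gamma> \<le> 0\<close>, \<open>O(|v - u| powr \<gamma>)\<close> near \<open>u = v\<close> and
  \<open>O(|u| powr (-7/2))\<close> at infinity. Schwartz functions satisfy this condition.\<close>

definition sufficient_decay :: "(real^3 \<Rightarrow> real) \<Rightarrow> bool" where
  "sufficient_decay F \<longleftrightarrow> (\<exists>C. \<forall>v. \<bar>F v\<bar> \<le> C / (1 + norm v) ^ 3 \<and>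
     (\<forall>j. \<bar>partial j F v\<bar> \<le> C / (1 + norm v) ^ 4))"

end

theory Submission
  imports Defs
begin

text \<open>Write \<open>Q\<close> for the collision operator and \<open>v\<^sub>0\<close> for \<open>energy c v\<close>. The theorem is the infinitesimal form
  of Lorentz covariance. If a Lorentz map \<open>L\<close> acts on momenta through the mass shell by \<open>T = act c L\<close>,
  then (\<open>collision_op_covariance\<close>)
  \<open>(T v)\<^sub>0 * Q h f (T v) = v\<^sub>0 * Q (h \<circ> T) (f \<circ> T) v\<close>.
  Three facts are behind it: \<open>du / u\<^sub>0\<close> is a Lorentz invariant measure; \<open>v\<^sub>0 u\<^sub>0\<close> times the kernel depends
  on Minkowski products only; and \<open>T\<close> maps the collision of \<open>v\<close> and \<open>u\<close> in direction \<open>\<omega>\<close> to the collision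
  of \<open>T v\<close> and \<open>T u\<close> in a direction \<open>R \<omega>\<close>, where \<open>R\<close> is a rotation that depends on \<open>v\<close>, \<open>u\<close> and \<open>L\<close> and
  leaves the surface measure invariant (\<open>collision_covariance\<close>).

  Differentiating \<open>Q h f\<close> directly would move the singularity of the kernel at \<open>u = v\<close>. On the
  right-hand side of the covariance identity the point \<open>v\<close> is fixed and the parameter occurs only in the
  smooth functions \<open>h \<circ> T\<close> and \<open>f \<circ> T\<close>, so dominated convergence applies
  (\<open>collision_op_has_derivative\<close>). The dominating function comes from a bound on the kernel of order
  \<open>\<bar>u\<bar> powr (-1/2)\<close> at infinity and \<open>\<bar>u - v\<bar> powr (-2)\<close> near \<open>v\<close>, and from conservation of energy, which turns
  decay in the outgoing momenta into decay in \<open>u\<close>.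

  For boosts, whose velocity fields are \<open>v\<^sub>0 \<partial>\<^sub>j\<close> up to normalisation, this gives the first identity; the
  term \<open>- v\<^sub>j / v\<^sub>0 * Q h f\<close> comes from the factor \<open>(T v)\<^sub>0\<close>. The boosts of \<open>v\<close> cover all momenta, and the
  boost leading to \<open>y\<close> depends smoothly on \<open>y\<close>, so differentiability of \<open>Q h f\<close> follows at the same time.
  For rotations the factor is constant, and the second identity results.\<close>

section \<open>Minkowski space, Lorentz maps and boosts\<close>

type_synonym spacetime = "real \<times> (real^3)"

definition mink :: "spacetime \<Rightarrow> spacetime \<Rightarrow> real" where
  "mink z w = fst z * fst w - snd z \<bullet> snd w"

text \<open>The map \<open>x \<mapsto> (energy c x, x)\<close> parametrises the mass shell by momentum. Momenta are
  three-vectors, but Lorentz maps are linear only on four-vectors, so identities between momenta are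
  proved after lifting them to the shell.\<close>

definition shell :: "real \<Rightarrow> real^3 \<Rightarrow> spacetime" where
  "shell c x = (energy c x, x)"

definition future :: "spacetime \<Rightarrow> bool" where
  "future z \<longleftrightarrow> norm (snd z) < fst z"

text \<open>The last conjunct makes the map orthochronous, so that it sends the mass shell to itself and
  not to its negative branch. Reflections of space are allowed.\<close>

definition lorentz :: "(spacetime \<Rightarrow> spacetime) \<Rightarrow> bool" where
  "lorentz L \<longleftrightarrow> linear L \<and> (\<forall>z w. mink (L z) (L w) = mink z w) \<and> (\<forall>z. future z \<longrightarrow> future (L z))"

text \<open>The pure boost in the direction of \<open>\<beta>\<close> whose half rapidity has \<open>tanh\<close> equal to \<open>norm \<beta>\<close>: its velocity is
  \<open>2 \<beta> / (1 + \<beta> \<bullet> \<beta>)\<close> in units of \<open>c\<close>. With this parameter the entries of the boost are rational in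
  \<open>\<beta>\<close>, the inverse is \<open>- \<beta>\<close>, and the boost joining two four-vectors has a simple parameter (see
  \<open>boost_between\<close>).\<close>

definition boost :: "real^3 \<Rightarrow> spacetime \<Rightarrow> spacetime" where
  "boost \<beta> z =
    (((1 + \<beta> \<bullet> \<beta>) * fst z + 2 * (\<beta> \<bullet> snd z)) / (1 - \<beta> \<bullet> \<beta>),
     snd z + (2 * (fst z + \<beta> \<bullet> snd z) / (1 - \<beta> \<bullet> \<beta>)) *\<^sub>R \<beta>)"

definition act :: "real \<Rightarrow> (spacetime \<Rightarrow> spacetime) \<Rightarrow> real^3 \<Rightarrow> real^3" where
  "act c L x = snd (L (shell c x))"

lemma lorentzD:
  assumes "lorentz L"
  shows "linear L" "mink (L z) (L w) = mink z w" "future z \<Longrightarrow> future (L z)"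
  using assms unfolding lorentz_def by blast+

lemma mink_add_left: "mink (x + y) z = mink x z + mink y z"
  and mink_add_right: "mink z (x + y) = mink z x + mink z y"
  and mink_diff_left: "mink (x - y) z = mink x z - mink y z"
  and mink_diff_right: "mink z (x - y) = mink z x - mink z y"
  and mink_scale_left: "mink (a *\<^sub>R x) z = a * mink x z"
  and mink_scale_right: "mink z (a *\<^sub>R x) = a * mink z x"
  by (auto simp: mink_def algebra_simps inner_simps)

lemma mink_sym: "mink x y = mink y x"
  by (simp add: mink_def inner_commute mult.commute)

lemmas mink_simps = mink_add_left mink_add_right mink_diff_left mink_diff_right
  mink_scale_left mink_scale_right

lemma future_iff: "future z \<longleftrightarrow> 0 < fst z \<and> 0 < mink z z"
proof -
  have "norm (snd z) < fst z \<longleftrightarrow> 0 < fst z \<and> (norm (snd z))\<^sup>2 < (fst z)\<^sup>2"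
    by (smt (verit, best) norm_ge_zero power2_eq_iff_nonneg power_strict_mono power_mono pos2)
  then show ?thesis
    by (simp add: future_def mink_def power2_norm_eq_inner) (simp add: power2_eq_square)
qed

lemma future_add: "future z \<Longrightarrow> future w \<Longrightarrow> future (z + w)"
  unfolding future_def by (simp, smt (verit) norm_triangle_ineq)

lemma inner_self_less_one: "norm (\<beta>::real^3) < 1 \<Longrightarrow> \<beta> \<bullet> \<beta> < 1"
  by (metis norm_ge_zero norm_eq_sqrt_inner real_sqrt_lt_1_iff)

lemma mink_boost:
  assumes "norm \<beta> < 1" shows "mink (boost \<beta> z) (boost \<beta> w) = mink z w"
proof -
  define b where "b = \<beta> \<bullet> \<beta>"
  define p where "p = \<beta> \<bullet> snd z"
  define r where "r = \<beta> \<bullet> snd w"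
  have b: "1 - b \<noteq> 0" using inner_self_less_one[OF assms] by (simp add: b_def)
  have "mink (boost \<beta> z) (boost \<beta> w) =
     (((1 + b) * fst z + 2 * p) / (1 - b)) * (((1 + b) * fst w + 2 * r) / (1 - b))
     - (snd z \<bullet> snd w + (2 * (fst z + p) / (1 - b)) * r + (2 * (fst w + r) / (1 - b)) * p
       + (2 * (fst z + p) / (1 - b)) * ((2 * (fst w + r) / (1 - b)) * b))"
    by (simp add: mink_def boost_def inner_simps b_def p_def r_def inner_commute)
  also have "\<dots> = fst z * fst w - snd z \<bullet> snd w"
    using b by (simp add: divide_simps) algebra
  finally show ?thesis by (simp add: mink_def)
qed

lemma boost_inverse:
  assumes "norm \<beta> < 1" shows "boost (- \<beta>) (boost \<beta> z) = z"
proof -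
  define b where "b = \<beta> \<bullet> \<beta>"
  define p where "p = \<beta> \<bullet> snd z"
  have b: "1 - b \<noteq> 0" using inner_self_less_one[OF assms] by (simp add: b_def)
  define z' where "z' = boost \<beta> z"
  have f: "fst z' = ((1 + b) * fst z + 2 * p) / (1 - b)"
    and s: "snd z' = snd z + (2 * (fst z + p) / (1 - b)) *\<^sub>R \<beta>"
    by (simp_all add: z'_def boost_def b_def p_def)
  have p': "\<beta> \<bullet> snd z' = p + (2 * (fst z + p) / (1 - b)) * b"
    by (simp add: s inner_simps b_def p_def)
  have k: "fst z' - \<beta> \<bullet> snd z' = fst z + p"
    unfolding f p' using b by (simp add: divide_simps) algebra
  have "fst (boost (- \<beta>) z') = ((1 + b) * fst z' - 2 * (\<beta> \<bullet> snd z')) / (1 - b)"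
    by (simp add: boost_def b_def)
  also have "\<dots> = fst z"
    unfolding f p' using b by (simp add: divide_simps) algebra
  finally have 1: "fst (boost (- \<beta>) z') = fst z" .
  have "snd (boost (- \<beta>) z') = snd z' - (2 * (fst z' - \<beta> \<bullet> snd z') / (1 - b)) *\<^sub>R \<beta>"
    by (simp add: boost_def b_def)
  also have "\<dots> = snd z" unfolding k unfolding s by simp
  finally show ?thesis using 1 by (simp add: prod_eq_iff z'_def)
qed

lemma linear_boost: "linear (boost \<beta>)"
  by (rule linearI)
    (simp_all add: boost_def prod_eq_iff inner_simps algebra_simps add_divide_distrib scaleR_left.add)

lemma lorentz_boost: assumes "norm \<beta> < 1" shows "lorentz (boost \<beta>)"
proof -
  have "future (boost \<beta> z)" if "future z" for z
  proof -
    have "- (2 * norm \<beta> * norm (snd z)) \<le> 2 * (\<beta> \<bullet> snd z)"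
      using Cauchy_Schwarz_ineq2[of \<beta> "snd z"] by auto
    moreover have "norm \<beta> * norm (snd z) \<le> norm \<beta> * fst z"
      using that by (intro mult_left_mono) (auto simp: future_def)
    moreover have "0 < (1 - norm \<beta>)\<^sup>2 * fst z"
      using that assms by (auto simp: future_iff)
    ultimately have "0 < (1 + \<beta> \<bullet> \<beta>) * fst z + 2 * (\<beta> \<bullet> snd z)"
      unfolding power2_norm_eq_inner[symmetric] by (simp add: power2_eq_square algebra_simps)
    then have "0 < fst (boost \<beta> z)"
      using inner_self_less_one[OF assms] by (simp add: boost_def)
    then show ?thesis using that assms by (simp add: future_iff mink_boost)
  qed
  then show ?thesis using assms by (simp add: lorentz_def linear_boost mink_boost)
qed

lemma lorentz_comp: "lorentz L \<Longrightarrow> lorentz M \<Longrightarrow> lorentz (L \<circ> M)"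
  unfolding lorentz_def using linear_compose[of M L] by (simp add: o_def del: split_paired_All)

text \<open>A boost changes the momentum by a multiple of its parameter, so \<open>\<beta>\<close> has to be parallel to
  \<open>snd Y - snd X\<close>. The half-rapidity form of the velocity difference of two vectors of equal mass
  fixes the factor: \<open>tanh ((a - b) / 2) = (sinh a - sinh b) / (cosh a + cosh b)\<close>. The formula is
  smooth in \<open>Y\<close>, also at \<open>Y = X\<close>; this is what lets derivatives in the boost parameter be turned
  into derivatives in the momentum.\<close>

lemma boost_between:
  assumes X: "future X" and Y: "future Y" and eq: "mink X X = mink Y Y"
    and \<beta>: "\<beta> = (snd Y - snd X) /\<^sub>R (fst Y + fst X)"
  shows "norm \<beta> < 1" "boost \<beta> X = Y"
proof -
  define S where "S = fst Y + fst X"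
  have S: "S > 0" using X Y by (auto simp: future_iff S_def)
  have "norm (snd Y - snd X) < S"
    using X Y norm_triangle_ineq4[of "snd Y" "snd X"] by (auto simp: future_def S_def)
  then show n: "norm \<beta> < 1" using S by (simp add: \<beta> S_def[symmetric] divide_simps)
  define b where "b = \<beta> \<bullet> \<beta>"
  define p where "p = \<beta> \<bullet> snd X"
  have b: "1 - b > 0" using inner_self_less_one[OF n] by (simp add: b_def)
  define r where "r = snd Y \<bullet> snd X"
  have yx: "snd Y \<bullet> snd Y = (fst Y)\<^sup>2 - mink X X" "snd X \<bullet> snd X = (fst X)\<^sup>2 - mink X X"
    using eq by (simp_all add: mink_def power2_eq_square)
  have bS: "b * S\<^sup>2 = (fst Y)\<^sup>2 + (fst X)\<^sup>2 - 2 * mink X X - 2 * r"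
    using S yx by (simp add: b_def \<beta> S_def[symmetric] r_def inner_simps inner_commute power2_eq_square divide_simps)
  have pS: "p * S = r - (fst X)\<^sup>2 + mink X X"
    using S yx by (simp add: p_def \<beta> S_def[symmetric] r_def inner_simps inner_commute divide_simps)
  have "2 * (fst X + p) = S * (1 - b)"
  proof -
    have "S * (2 * (fst X + p)) = 2 * fst X * S + 2 * (p * S)" by (simp add: algebra_simps)
    also have "\<dots> = S\<^sup>2 - b * S\<^sup>2" unfolding pS bS by (simp add: S_def power2_eq_square algebra_simps)
    also have "\<dots> = S * (S * (1 - b))" by (simp add: power2_eq_square algebra_simps)
    finally show ?thesis using S by simp
  qed
  then have k: "2 * (fst X + p) / (1 - b) = S" using b by (simp add: divide_simps)
  have s: "snd (boost \<beta> X) = snd Y"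
    using k S by (simp add: boost_def b_def p_def) (simp add: \<beta> S_def)
  have f: "future (boost \<beta> X)" using lorentzD(3)[OF lorentz_boost[OF n] X] .
  have "mink (boost \<beta> X) (boost \<beta> X) = mink Y Y" using mink_boost[OF n] eq by simp
  then have "fst (boost \<beta> X) * fst (boost \<beta> X) = fst Y * fst Y" by (simp add: mink_def s)
  then have "fst (boost \<beta> X) = fst Y"
    using f Y by (auto simp: future_iff square_eq_iff)
  then show "boost \<beta> X = Y" using s by (simp add: prod_eq_iff)
qed

lemma energy_pos: "c > 0 \<Longrightarrow> energy c x > 0"
  by (simp add: energy_def add_pos_nonneg)

lemma energy_sq: "(energy c x)\<^sup>2 = c\<^sup>2 + x \<bullet> x"
  unfolding energy_def by (simp add: power2_norm_eq_inner)

lemma mink_shell_self: "mink (shell c x) (shell c x) = c\<^sup>2"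
  using energy_sq[of c x] unfolding mink_def shell_def power2_eq_square fst_conv snd_conv by linarith

lemma future_shell: "c > 0 \<Longrightarrow> future (shell c x)"
  unfolding future_iff mink_shell_self by (simp add: shell_def energy_pos)

text \<open>A future vector of mass \<open>c\<close> is determined by its spatial part. Through this lemma no square
  root of a transformed energy ever has to be computed.\<close>

lemma shell_eqI:
  assumes "c > 0" "future z" "mink z z = c\<^sup>2" shows "shell c (snd z) = z"
proof -
  have "(energy c (snd z))\<^sup>2 = (fst z)\<^sup>2"
    using assms(3) unfolding energy_sq mink_def power2_eq_square[of "fst z"] by linarith
  moreover have "fst z > 0" "energy c (snd z) > 0" using assms by (auto simp: future_iff energy_pos)
  ultimately have "energy c (snd z) = fst z" by (metis less_imp_le power2_eq_iff_nonneg)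
  then show ?thesis by (simp add: shell_def)
qed

lemma shell_act:
  assumes c: "c > 0" and L: "lorentz L"
  shows "shell c (act c L x) = L (shell c x)"
  unfolding act_def
proof (rule shell_eqI[OF c])
  show "future (L (shell c x))" by (rule lorentzD(3)[OF L future_shell[OF c]])
  show "mink (L (shell c x)) (L (shell c x)) = c\<^sup>2" by (simp add: lorentzD(2)[OF L] mink_shell_self)
qed

text \<open>If the time axis is fixed, so is its orthogonal complement, on which the form is minus the
  Euclidean one. This is how Wigner rotations arise below.\<close>

lemma rest_frame_stabilizer:
  assumes L: "lorentz L" and m: "m > 0" and stable: "L (m, 0) = (m, 0)"
  obtains R where "orthogonal_transformation R" "\<And>a x. L (a, x) = (a, R x)"
proof
  have lin: "linear L" and mk: "mink (L z) (L w) = mink z w" for z w using lorentzD[OF L] by auto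
  define R where "R = (\<lambda>x. snd (L (0, x)))"
  have e: "L (a, 0) = (a, 0)" for a
    using linear_cmul[OF lin, of "a / m" "(m, 0)"] m stable by simp
  have 0: "L (0, x) = (0, R x)" for x
    using mk[of "(1, 0)" "(0, x)"] unfolding e R_def by (simp add: mink_def prod_eq_iff)
  show "L (a, x) = (a, R x)" for a x
    using linear_add[OF lin, of "(a, 0)" "(0, x)"] by (simp add: e 0)
  show "orthogonal_transformation R"
    unfolding orthogonal_transformation
  proof
    show "linear R" unfolding R_def
      using linear_add[OF lin, of "(0, x)" "(0, y)" for x y] linear_cmul[OF lin, of _ "(0, x)" for x]
      by (intro linearI) auto
    show "\<forall>v. norm (R v) = norm v"
      using mk[of "(0, x)" "(0, x)" for x] by (simp add: 0 mink_def norm_eq_sqrt_inner)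
  qed
qed

lemma lorentz_rotation:
  assumes "orthogonal_transformation R"
  shows "lorentz (\<lambda>z. (fst z, R (snd z)))"
  unfolding lorentz_def
proof (intro conjI allI impI)
  have lin: "linear R" using assms by (simp add: orthogonal_transformation_def)
  show "linear (\<lambda>z. (fst z, R (snd z)))"
    by (rule linearI) (simp_all add: linear_add[OF lin] linear_cmul[OF lin])
  show "mink (fst z, R (snd z)) (fst w, R (snd w)) = mink z w" for z w
    using assms by (simp add: mink_def orthogonal_transformation_def)
  show "future (fst z, R (snd z))" if "future z" for z
    using that assms by (simp add: future_def orthogonal_transformation_norm)
qed

section \<open>Covariance of a binary collision\<close>

definition four_momentum :: "real \<Rightarrow> real^3 \<Rightarrow> real^3 \<Rightarrow> spacetime" where
  "four_momentum c v u = shell c v + shell c u"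

text \<open>The reversed Cauchy-Schwarz inequality on the mass shell; it makes the argument of the square
  root in \<open>rel_g\<close> nonnegative.\<close>

lemma mink_shell_ge: assumes "c > 0" shows "c\<^sup>2 \<le> mink (shell c v) (shell c u)"
proof -
  have "(v \<bullet> u + c\<^sup>2)\<^sup>2 \<le> (energy c v * energy c u)\<^sup>2"
  proof -
    have "(v \<bullet> u)\<^sup>2 \<le> (v \<bullet> v) * (u \<bullet> u)" by (rule Cauchy_Schwarz_ineq)
    moreover have "0 \<le> c\<^sup>2 * ((v - u) \<bullet> (v - u))" by simp
    then have "0 \<le> c\<^sup>2 * (v \<bullet> v) + c\<^sup>2 * (u \<bullet> u) - 2 * (c\<^sup>2 * (v \<bullet> u))"
      by (simp add: inner_diff_left inner_diff_right inner_commute algebra_simps del: zero_le_mult_iff)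
    ultimately show ?thesis
      unfolding power_mult_distrib energy_sq by (simp add: power2_sum algebra_simps)
  qed
  then have "v \<bullet> u + c\<^sup>2 \<le> energy c v * energy c u"
    by (rule power2_le_imp_le) (use energy_pos[OF assms] in \<open>simp add: less_imp_le\<close>)
  then show ?thesis by (simp add: mink_def shell_def)
qed

lemma rel_g_mink: "rel_g c v u = sqrt (2 * (mink (shell c v) (shell c u) - c\<^sup>2))"
  by (simp add: rel_g_def mink_def shell_def)

lemma rel_g_nonneg: "c > 0 \<Longrightarrow> rel_g c v u \<ge> 0"
  using mink_shell_ge[of c v u] by (simp add: rel_g_mink)

lemma rel_g_sq:
  assumes "c > 0"
  shows "(rel_g c v u)\<^sup>2 = - mink (shell c v - shell c u) (shell c v - shell c u)"
proof -
  have "(rel_g c v u)\<^sup>2 = 2 * (mink (shell c v) (shell c u) - c\<^sup>2)"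
    using mink_shell_ge[OF assms, of v u] by (simp add: rel_g_mink)
  then show ?thesis
    by (simp add: mink_simps mink_shell_self mink_sym[of "shell c u" "shell c v"])
qed

lemma rel_s_mink: "rel_s c v u = mink (four_momentum c v u) (four_momentum c v u)"
  by (simp add: rel_s_def four_momentum_def mink_simps mink_shell_self mink_sym[of "shell c u" "shell c v"])
     (simp add: shell_def mink_def)

lemma rel_s_g: "c > 0 \<Longrightarrow> rel_s c v u = (rel_g c v u)\<^sup>2 + 4 * c\<^sup>2"
  by (simp add: rel_g_sq rel_s_mink four_momentum_def mink_simps mink_shell_self mink_sym[of "shell c u" "shell c v"])

lemma future_four_momentum: "c > 0 \<Longrightarrow> future (four_momentum c v u)"
  unfolding four_momentum_def by (intro future_add future_shell)

text \<open>The parameter of the boost from the centre-of-mass frame of the pair to the frame in which the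
  momenta are \<open>v\<close> and \<open>u\<close>.\<close>

definition com_velocity :: "real \<Rightarrow> real^3 \<Rightarrow> real^3 \<Rightarrow> real^3" where
  "com_velocity c v u = (v + u) /\<^sub>R (energy c v + energy c u + sqrt (rel_s c v u))"

lemma com_boost:
  assumes "c > 0"
  shows "sqrt (rel_s c v u) > 0" "norm (com_velocity c v u) < 1"
    "boost (com_velocity c v u) (sqrt (rel_s c v u), 0) = four_momentum c v u"
proof -
  have s: "rel_s c v u > 0" using future_four_momentum[OF assms, of v u] by (simp add: rel_s_mink future_iff)
  then show "sqrt (rel_s c v u) > 0" by simp
  have 1: "future (sqrt (rel_s c v u), 0)" using s by (simp add: future_def)
  have 2: "mink (sqrt (rel_s c v u), 0) (sqrt (rel_s c v u), 0) = mink (four_momentum c v u) (four_momentum c v u)"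
    unfolding rel_s_mink[symmetric] using s by (simp add: mink_def)
  have 3: "com_velocity c v u = (snd (four_momentum c v u) - snd (sqrt (rel_s c v u), 0::real^3)) /\<^sub>R
      (fst (four_momentum c v u) + fst (sqrt (rel_s c v u), 0::real^3))"
    by (simp add: com_velocity_def four_momentum_def shell_def)
  show "norm (com_velocity c v u) < 1"
    "boost (com_velocity c v u) (sqrt (rel_s c v u), 0) = four_momentum c v u"
    using boost_between[OF 1 future_four_momentum[OF assms] 2 3] by auto
qed

text \<open>The formula for the deflection is the spatial part of a boosted vector: in the centre-of-mass
  frame the collision turns the relative momentum into \<open>rel_g c v u / 2\<close> times the direction \<open>\<omega>\<close>.\<close>

lemma deflection_boost:
  assumes c: "c > 0"
  shows "deflection c v u \<omega> = (rel_g c v u / 2) *\<^sub>R snd (boost (com_velocity c v u) (0, \<omega>))"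
proof -
  define m where "m = sqrt (rel_s c v u)"
  define P where "P = v + u"
  define P0 where "P0 = energy c v + energy c u"
  define S where "S = P0 + m"
  have m: "m > 0" unfolding m_def by (rule com_boost(1)[OF c])
  then have S: "S > 0" by (simp add: S_def P0_def add_pos_pos energy_pos[OF c])
  have ms: "m\<^sup>2 = P0\<^sup>2 - P \<bullet> P"
    using com_boost(1)[OF c, of v u] by (simp add: m_def rel_s_mink mink_def four_momentum_def shell_def P0_def P_def power2_eq_square)
  have b: "com_velocity c v u = P /\<^sub>R S" by (simp add: com_velocity_def P_def P0_def m_def S_def)
  have "S\<^sup>2 - P \<bullet> P = 2 * m * S" unfolding S_def using ms by (simp add: power2_eq_square algebra_simps)
  then have bb: "1 - (P /\<^sub>R S) \<bullet> (P /\<^sub>R S) = 2 * m / S"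
    using S by (simp add: power2_eq_square divide_simps)
  have "(2 * ((P /\<^sub>R S) \<bullet> \<omega>) / (2 * m / S)) *\<^sub>R (P /\<^sub>R S) = ((P \<bullet> \<omega>) / (m * S)) *\<^sub>R P"
    using S m by (simp add: divide_simps)
  then have "snd (boost (com_velocity c v u) (0, \<omega>)) = \<omega> + ((P \<bullet> \<omega>) / (m * S)) *\<^sub>R P"
    unfolding b boost_def snd_conv bb by simp
  then show ?thesis by (simp add: deflection_def m_def S_def P_def P0_def)
qed

text \<open>Lifted to four-vectors, a collision replaces the halved difference of the incoming momenta by
  a boosted spatial vector of the same length, and keeps the total momentum. The right-hand sides lie
  on the mass shell because in the centre-of-mass frame they are \<open>(m/2, \<plusminus>(g/2) \<omega>)\<close> with
  \<open>m\<^sup>2 = g\<^sup>2 + 4 c\<^sup>2\<close>.\<close>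

lemma shell_post:
  assumes c: "c > 0" and \<omega>: "norm \<omega> = 1"
  shows "shell c (post_v c v u \<omega>) =
      (1/2) *\<^sub>R four_momentum c v u + (rel_g c v u / 2) *\<^sub>R boost (com_velocity c v u) (0, \<omega>)" (is "_ = ?V")
    and "shell c (post_u c v u \<omega>) =
      (1/2) *\<^sub>R four_momentum c v u - (rel_g c v u / 2) *\<^sub>R boost (com_velocity c v u) (0, \<omega>)" (is "_ = ?U")
proof -
  define m where "m = sqrt (rel_s c v u)"
  define g where "g = rel_g c v u"
  define B where "B = boost (com_velocity c v u)"
  have n: "norm (com_velocity c v u) < 1" by (rule com_boost[OF c])
  have m: "m > 0" and P: "B (m, 0) = four_momentum c v u" and L: "lorentz B" 
    using com_boost[OF c] lorentz_boost[OF n] by (auto simp: m_def B_def)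
  have lin: "linear B" by (rule lorentzD(1)[OF L])
  have mg: "m\<^sup>2 = g\<^sup>2 + 4 * c\<^sup>2" using rel_s_g[OF c, of v u] m by (simp add: m_def g_def)
  have g: "0 \<le> g" "g < m"
  proof -
    show "0 \<le> g" by (simp add: g_def rel_g_nonneg c)
    have "g\<^sup>2 < m\<^sup>2" using mg c by simp
    then show "g < m" using m by (simp add: power_less_imp_less_base)
  qed
  have gen: "shell c (snd (B (m/2, (k/2) *\<^sub>R \<omega>))) = B (m/2, (k/2) *\<^sub>R \<omega>)" if "\<bar>k\<bar> = g" for k
  proof (rule shell_eqI[OF c])
    have "future (m/2, (k/2) *\<^sub>R \<omega>)" using g that \<omega> by (simp add: future_def)
    then show "future (B (m/2, (k/2) *\<^sub>R \<omega>))" by (rule lorentzD(3)[OF L])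
    have "k\<^sup>2 = g\<^sup>2" using that by (metis power2_abs)
    have "mink (B (m/2, (k/2) *\<^sub>R \<omega>)) (B (m/2, (k/2) *\<^sub>R \<omega>)) = mink (m/2, (k/2) *\<^sub>R \<omega>) (m/2, (k/2) *\<^sub>R \<omega>)"
      by (rule lorentzD(2)[OF L])
    also have "\<dots> = m\<^sup>2/4 - k\<^sup>2/4 * (\<omega> \<bullet> \<omega>)" by (simp add: mink_def power2_eq_square)
    also have "\<omega> \<bullet> \<omega> = 1" using \<omega> by (simp add: norm_eq_1)
    finally show "mink (B (m/2, (k/2) *\<^sub>R \<omega>)) (B (m/2, (k/2) *\<^sub>R \<omega>)) = c\<^sup>2"
      using mg \<open>k\<^sup>2 = g\<^sup>2\<close> by (simp add: add_divide_distrib)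
  qed
  have split: "B (m/2, (k/2) *\<^sub>R \<omega>) = (1/2) *\<^sub>R four_momentum c v u + (k/2) *\<^sub>R B (0, \<omega>)" for k
  proof -
    have "B (m/2, (k/2) *\<^sub>R \<omega>) = B ((1/2) *\<^sub>R (m, 0) + (k/2) *\<^sub>R (0, \<omega>))" by simp
    also have "\<dots> = (1/2) *\<^sub>R B (m, 0) + (k/2) *\<^sub>R B (0, \<omega>)"
      by (simp only: linear_add[OF lin] linear_cmul[OF lin])
    finally show ?thesis by (simp only: P)
  qed
  have "post_v c v u \<omega> = snd ((1/2) *\<^sub>R four_momentum c v u + (g/2) *\<^sub>R B (0, \<omega>))"
    "post_u c v u \<omega> = snd ((1/2) *\<^sub>R four_momentum c v u + ((-g)/2) *\<^sub>R B (0, \<omega>))"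
    by (simp_all add: post_v_def post_u_def deflection_boost[OF c] g_def B_def four_momentum_def shell_def)
  then show "shell c (post_v c v u \<omega>) = ?V" "shell c (post_u c v u \<omega>) = ?U"
    using gen[of g] gen[of "-g"] g unfolding split by (simp_all add: B_def g_def)
qed

lemma cos_angle_mink:
  "cos_scattering_angle c v u \<omega> =
    - mink (shell c v - shell c u) (shell c (post_v c v u \<omega>) - shell c (post_u c v u \<omega>)) / (rel_g c v u)\<^sup>2"
  by (simp add: cos_scattering_angle_def mink_def shell_def)
    (simp add: divide_simps algebra_simps)

lemma rel_g_act: "c > 0 \<Longrightarrow> lorentz L \<Longrightarrow> rel_g c (act c L v) (act c L u) = rel_g c v u"
  by (simp add: rel_g_mink shell_act lorentzD(2)[of L])

lemma rel_s_act: "c > 0 \<Longrightarrow> lorentz L \<Longrightarrow> rel_s c (act c L v) (act c L u) = rel_s c v u"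
  by (simp add: rel_s_mink four_momentum_def shell_act lorentzD(2)[of L] linear_add[OF lorentzD(1)[of L], symmetric])

text \<open>A Lorentz map sends the centre-of-mass boost of \<open>(v, u)\<close> to that of the transformed pair only
  up to a map \<open>M\<close> fixing the time axis, that is, up to a rotation \<open>R\<close> of \<open>\<omega>\<close> (the Wigner rotation, which
  depends on \<open>v\<close>, \<open>u\<close> and \<open>L\<close>). Once \<open>\<omega>\<close> is rotated, the collision is covariant. The kernel times both
  energies is built from \<open>rel_g\<close>, \<open>rel_s\<close> and the scattering angle, which are functions of Minkowski
  products.\<close>

lemma collision_covariance:
  assumes c: "c > 0" and L: "lorentz L"
  obtains R where "orthogonal_transformation R"
    "\<And>\<omega>. norm \<omega> = 1 \<Longrightarrow> post_v c (act c L v) (act c L u) (R \<omega>) = act c L (post_v c v u \<omega>)"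
    "\<And>\<omega>. norm \<omega> = 1 \<Longrightarrow> post_u c (act c L v) (act c L u) (R \<omega>) = act c L (post_u c v u \<omega>)"
    "\<And>\<omega>. norm \<omega> = 1 \<Longrightarrow>
       energy c (act c L v) * energy c (act c L u) * collision_kernel c \<gamma> \<sigma>\<^sub>0 (act c L v) (act c L u) (R \<omega>)
       = energy c v * energy c u * collision_kernel c \<gamma> \<sigma>\<^sub>0 v u \<omega>"
proof -
  define v1 u1 where "v1 = act c L v" and "u1 = act c L u"
  define B B1 where "B = boost (com_velocity c v u)" and "B1 = boost (com_velocity c v1 u1)"
  have n: "norm (com_velocity c v u) < 1" "norm (com_velocity c v1 u1) < 1" by (rule com_boost[OF c])+
  have lin: "linear L" by (rule lorentzD(1)[OF L])
  have sh: "shell c v1 = L (shell c v)" "shell c u1 = L (shell c u)"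
    by (simp_all add: v1_def u1_def shell_act c L)
  have g: "rel_g c v1 u1 = rel_g c v u" and s: "rel_s c v1 u1 = rel_s c v u"
    by (simp_all add: v1_def u1_def rel_g_act rel_s_act c L)
  have tot: "four_momentum c v1 u1 = L (four_momentum c v u)" by (simp add: four_momentum_def sh linear_add[OF lin])
  \<comment> \<open>\<open>M\<close> goes up to the frame of the pair, through \<open>L\<close>, and back to the new centre-of-mass frame.\<close>
  define M where "M = boost (- com_velocity c v1 u1) \<circ> (L \<circ> B)"
  have M: "lorentz M" unfolding M_def B_def
    by (intro lorentz_comp lorentz_boost L) (use n in auto)
  have inv: "B1 (M z) = L (B z)" for z
    using boost_inverse[of "- com_velocity c v1 u1"] n by (simp add: M_def B1_def)
  have "M (sqrt (rel_s c v u), 0) = boost (- com_velocity c v1 u1) (L (four_momentum c v u))"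
    by (simp add: M_def B_def com_boost[OF c])
  also have "\<dots> = boost (- com_velocity c v1 u1) (B1 (sqrt (rel_s c v1 u1), 0))"
    by (simp add: B1_def com_boost[OF c] tot)
  also have "\<dots> = (sqrt (rel_s c v u), 0)" by (simp add: B1_def boost_inverse n s)
  finally obtain R where R: "orthogonal_transformation R" "\<And>a x. M (a, x) = (a, R x)"
    using rest_frame_stabilizer[OF M com_boost(1)[OF c]] by metis
  have Rn: "norm (R \<omega>) = norm \<omega>" for \<omega> using R by (simp add: orthogonal_transformation_norm)
  have B: "B1 (0, R \<omega>) = L (B (0, \<omega>))" for \<omega> using inv[of "(0, \<omega>)"] by (simp add: R)
  have post: "shell c (post_v c v1 u1 (R \<omega>)) = L (shell c (post_v c v u \<omega>))"
    "shell c (post_u c v1 u1 (R \<omega>)) = L (shell c (post_u c v u \<omega>))" if "norm \<omega> = 1" for \<omega>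
    using that by (simp_all add: shell_post[OF c] Rn tot B1_def[symmetric] B g B_def[symmetric]
        linear_add[OF lin] linear_diff[OF lin] linear_cmul[OF lin])
  have cos: "cos_scattering_angle c v1 u1 (R \<omega>) = cos_scattering_angle c v u \<omega>" if "norm \<omega> = 1" for \<omega>
    unfolding cos_angle_mink post[OF that] g sh linear_diff[OF lin, symmetric]
    by (simp add: lorentzD(2)[OF L])
  show thesis
  proof (rule that[OF R(1)])
    fix \<omega> :: "real^3" assume o: "norm \<omega> = 1"
    have [simp]: "snd (shell c x) = x" for x by (simp add: shell_def)
    show "post_v c (act c L v) (act c L u) (R \<omega>) = act c L (post_v c v u \<omega>)"
      "post_u c (act c L v) (act c L u) (R \<omega>) = act c L (post_u c v u \<omega>)"
      using arg_cong[OF post(1)[OF o], of snd] arg_cong[OF post(2)[OF o], of snd]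
      by (simp_all add: act_def v1_def u1_def)
    have "energy c x * energy c y * moller_velocity c x y = c * rel_g c x y * sqrt (rel_s c x y) / 4" for x y
      using energy_pos[OF c, of x] energy_pos[OF c, of y] by (simp add: moller_velocity_def)
    from this[of v1 u1] this[of v u]
    have "energy c v1 * energy c u1 * moller_velocity c v1 u1 = energy c v * energy c u * moller_velocity c v u"
      using g s by simp
    moreover have "cross_section \<gamma> \<sigma>\<^sub>0 (rel_g c v1 u1) (scattering_angle c v1 u1 (R \<omega>)) =
        cross_section \<gamma> \<sigma>\<^sub>0 (rel_g c v u) (scattering_angle c v u \<omega>)"
      by (simp add: scattering_angle_def cos[OF o] g)
    ultimately show "energy c (act c L v) * energy c (act c L u) * collision_kernel c \<gamma> \<sigma>\<^sub>0 (act c L v) (act c L u) (R \<omega>)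
       = energy c v * energy c u * collision_kernel c \<gamma> \<sigma>\<^sub>0 v u \<omega>"
      unfolding v1_def[symmetric] u1_def[symmetric] collision_kernel_def mult.assoc[symmetric] by simp
  qed
qed

section \<open>Invariant measures on the mass shell and the sphere\<close>

text \<open>The change of variables theorem for the Henstock-Kurzweil integral concerns vector-valued
  functions; \<open>V\<close> below wraps a real function as one with values in \<open>real^1\<close>. That theorem is an
  equivalence, so if \<open>F\<close> is not integrable, neither is the other integrand, and both integrals
  are \<open>0\<close> by convention.\<close>

lemma lborel_change_of_variables:
  fixes T :: "real^3 \<Rightarrow> real^3" and F :: "real^3 \<Rightarrow> real"
  assumes der: "\<And>x. (T has_derivative T' x) (at x)"
    and inj: "inj T" and surj: "surj T"
    and J: "\<And>x. \<bar>det (matrix (T' x))\<bar> = J x"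
    and [measurable]: "J \<in> borel_measurable borel" "F \<in> borel_measurable borel"
  shows "(LINT x|lborel. J x * F (T x)) = (LINT x|lborel. F x)"
proof -
  have "continuous_on UNIV T"
    by (simp add: continuous_at_imp_continuous_on has_derivative_continuous[OF der])
  then have [measurable]: "T \<in> borel_measurable borel" by (rule borel_measurable_continuous_onI)
  define V where "V = (\<lambda>r::real. (\<chi> i. r) :: real^1)"
  have V: "bounded_linear V"
    by (rule linear_conv_bounded_linear[THEN iffD1]) (auto simp: V_def vec_eq_iff intro!: linearI)
  have main: "(\<lambda>x. \<bar>det (matrix (T' x))\<bar> *\<^sub>R V (F (T x))) absolutely_integrable_on UNIV \<and>
           integral UNIV (\<lambda>x. \<bar>det (matrix (T' x))\<bar> *\<^sub>R V (F (T x))) = b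
     \<longleftrightarrow> (\<lambda>x. V (F x)) absolutely_integrable_on (T ` UNIV) \<and> integral (T ` UNIV) (\<lambda>x. V (F x)) = b" for b
    using has_absolute_integral_change_of_variables[of UNIV T T' "\<lambda>x. V (F x)" b] der inj by simp
  have sc: "\<bar>det (matrix (T' x))\<bar> *\<^sub>R V (F (T x)) = V (J x * F (T x))" for x
    by (simp add: J V_def vec_eq_iff)
  have ai: "(\<lambda>x. V (G x)) absolutely_integrable_on UNIV \<longleftrightarrow> integrable lborel G"
    and int: "integrable lborel G \<Longrightarrow> integral UNIV (\<lambda>x. V (G x)) = V (LINT x|lborel. G x)"
    if [measurable]: "G \<in> borel_measurable borel" for G :: "real^3 \<Rightarrow> real"
  proof -
    have G: "G absolutely_integrable_on UNIV \<longleftrightarrow> integrable lborel G"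
      by (simp add: set_integrable_def integrable_completion)
    show "(\<lambda>x. V (G x)) absolutely_integrable_on UNIV \<longleftrightarrow> integrable lborel G"
      unfolding G[symmetric]
    proof
      assume "(\<lambda>x. V (G x)) absolutely_integrable_on UNIV"
      from absolutely_integrable_linear[OF this bounded_linear_vec_nth[of 1]]
      show "G absolutely_integrable_on UNIV" by (simp add: o_def V_def)
    next
      assume "G absolutely_integrable_on UNIV"
      from absolutely_integrable_linear[OF this V]
      show "(\<lambda>x. V (G x)) absolutely_integrable_on UNIV" by (simp add: o_def)
    qed
    assume "integrable lborel G"
    then have "(G has_integral (LINT x|lborel. G x)) UNIV" by (rule has_integral_integral_lborel)
    from has_integral_linear[OF this V]
    show "integral UNIV (\<lambda>x. V (G x)) = V (LINT x|lborel. G x)"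
      by (simp add: o_def integral_unique)
  qed
  have Vinj: "V a = V b \<Longrightarrow> a = b" for a b by (simp add: V_def vec_eq_iff)
  show ?thesis
  proof (cases "integrable lborel F")
    case True
    then have "(\<lambda>x. V (J x * F (T x))) absolutely_integrable_on UNIV"
      and eq: "integral UNIV (\<lambda>x. V (J x * F (T x))) = V (LINT x|lborel. F x)"
      using main[of "V (LINT x|lborel. F x)"] surj ai[of F] int[of F] unfolding sc by auto
    then have "integrable lborel (\<lambda>x. J x * F (T x))" using ai[of "\<lambda>x. J x * F (T x)"] by simp
    then have "integral UNIV (\<lambda>x. V (J x * F (T x))) = V (LINT x|lborel. J x * F (T x))"
      by (intro int) measurable
    then show ?thesis using eq Vinj by simp
  next
    case False
    then have "\<not> integrable lborel (\<lambda>x. J x * F (T x))"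
      using main[of "integral UNIV (\<lambda>x. V (J x * F (T x)))"] surj ai[of F]
        ai[of "\<lambda>x. J x * F (T x)"] unfolding sc by simp
    then show ?thesis using False by (simp add: not_integrable_integral_eq)
  qed
qed

lemma det_rank_one_update: "det (matrix (\<lambda>e::real^3. e + (y \<bullet> e) *\<^sub>R w)) = 1 + y \<bullet> w"
  by (simp add: matrix_def det_3 inner_axis axis_def inner_vec_def sum_3) algebra

lemma act_boost: "act c (boost \<beta>) x = x + (2 * (energy c x + \<beta> \<bullet> x) / (1 - \<beta> \<bullet> \<beta>)) *\<^sub>R \<beta>"
  by (simp add: act_def boost_def shell_def)

lemma has_derivative_energy:
  assumes "c > 0" shows "(energy c has_derivative (\<lambda>e. x \<bullet> e / energy c x)) (at x)"
proof -
  have eq: "energy c = (\<lambda>x. sqrt (c\<^sup>2 + x \<bullet> x))"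
    by (auto simp: energy_def power2_norm_eq_inner)
  have "c\<^sup>2 + x \<bullet> x > 0" using assms by (simp add: add_pos_nonneg)
  then show ?thesis unfolding eq
    by (auto intro!: derivative_eq_intros simp: inner_commute divide_simps)
qed

lemma borel_measurable_energy [measurable]: "energy c \<in> borel_measurable borel"
  unfolding energy_def[abs_def] by measurable

lemma act_inverse:
  assumes "c > 0" "norm \<beta> < 1"
  shows "act c (boost (- \<beta>)) (act c (boost \<beta>) x) = x"
  using shell_act[OF assms(1) lorentz_boost[OF assms(2)], of x]
  by (simp add: act_def[of c "boost (- \<beta>)"] boost_inverse[OF assms(2)]) (simp add: shell_def)

lemma borel_measurable_act_boost [measurable]: "act c (boost \<beta>) \<in> borel_measurable borel"
  unfolding act_boost[abs_def] by measurable

text \<open>The derivative of a boost is a rank-one update of the identity, so its determinant is read off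
  from \<open>det_rank_one_update\<close>: it is the ratio of the new energy to the old one.\<close>

lemma boost_invariant_measure:
  assumes c: "c > 0" and \<beta>: "norm \<beta> < 1" and [measurable]: "F \<in> borel_measurable borel"
  shows "(LINT u|lborel. F (act c (boost \<beta>) u) / energy c u) = (LINT u|lborel. F u / energy c u)"
proof -
  define T where "T = act c (boost \<beta>)"
  have [measurable]: "T \<in> borel_measurable borel" by (simp add: T_def)
  define q where "q = 1 - \<beta> \<bullet> \<beta>"
  have q: "q > 0" using inner_self_less_one[OF \<beta>] by (simp add: q_def)
  have E: "energy c x > 0" for x by (rule energy_pos[OF c])
  have der: "(T has_derivative (\<lambda>e. e + (((2 / q) *\<^sub>R ((1 / energy c x) *\<^sub>R x + \<beta>)) \<bullet> e) *\<^sub>R \<beta>)) (at x)" for x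
    unfolding T_def act_boost[abs_def] q_def[symmetric]
    using q
    by (auto intro!: derivative_eq_intros has_derivative_energy[OF c] ext
        simp: inner_simps inner_commute algebra_simps add_divide_distrib)
  have ET: "energy c (T x) = ((1 + \<beta> \<bullet> \<beta>) * energy c x + 2 * (\<beta> \<bullet> x)) / q" for x
    using arg_cong[OF shell_act[OF c lorentz_boost[OF \<beta>], of x], of fst]
    by (simp add: T_def q_def boost_def shell_def)
  have J: "\<bar>det (matrix (\<lambda>e. e + (((2 / q) *\<^sub>R ((1 / energy c x) *\<^sub>R x + \<beta>)) \<bullet> e) *\<^sub>R \<beta>))\<bar>
      = energy c (T x) / energy c x" for x
  proof -
    have "1 + ((2 / q) *\<^sub>R ((1 / energy c x) *\<^sub>R x + \<beta>)) \<bullet> \<beta> = energy c (T x) / energy c x"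
      unfolding ET using q E[of x]
      by (simp add: inner_simps inner_commute divide_simps) (simp add: q_def algebra_simps)
    moreover have "energy c (T x) / energy c x > 0" using E by simp
    ultimately show ?thesis unfolding det_rank_one_update by (simp only: abs_of_pos)
  qed
  have inv: "act c (boost (- \<beta>)) (T x) = x" "T (act c (boost (- \<beta>)) x) = x" for x
    using act_inverse[OF c, of \<beta> x] act_inverse[OF c, of "- \<beta>" x] \<beta> by (auto simp: T_def)
  have "inj T" "surj T" by (metis injI inv(1), metis surjI inv(2))
  from lborel_change_of_variables[OF der this J, of "\<lambda>u. F u / energy c u"]
  have "(LINT x|lborel. energy c (T x) / energy c x * (F (T x) / energy c (T x))) = (LINT u|lborel. F u / energy c u)"
    by measurable
  moreover have "energy c (T x) / energy c x * (F (T x) / energy c (T x)) = F (T x) / energy c x" for x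
    using E[of "T x"] by simp
  ultimately show ?thesis by (simp add: T_def)
qed

lemma borel_measurable_linear_vec: "linear R \<Longrightarrow> (R :: real^3 \<Rightarrow> real^3) \<in> borel_measurable borel"
  by (intro borel_measurable_continuous_onI linear_continuous_on) (simp add: linear_conv_bounded_linear)

lemma rotation_invariant_lborel:
  fixes F :: "real^3 \<Rightarrow> real" and R :: "real^3 \<Rightarrow> real^3"
  assumes R: "orthogonal_transformation R" and [measurable]: "F \<in> borel_measurable borel"
  shows "(LINT x|lborel. F (R x)) = (LINT x|lborel. F x)"
proof -
  have lin: "linear R" using R by (simp add: orthogonal_transformation_def)
  have "(LINT x|lborel. 1 * F (R x)) = (LINT x|lborel. F x)"
  proof (rule lborel_change_of_variables[where T' = "\<lambda>_. R"])
    show "(R has_derivative R) (at x)" for x using lin by (rule linear_imp_has_derivative)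
    show "inj R" "surj R" using R
      by (rule orthogonal_transformation_inj, rule orthogonal_transformation_surj)
    show "\<bar>det (matrix R)\<bar> = 1" using R by (rule orthogonal_transformation_det)
  qed measurable
  then show ?thesis by simp
qed

lemma energy_rotation: "orthogonal_transformation R \<Longrightarrow> energy c (R x) = energy c x"
  by (simp add: energy_def orthogonal_transformation_norm)

text \<open>If \<open>\<beta>\<close> boosts the rest momentum to its image under \<open>L\<close>, then \<open>boost (- \<beta>) \<circ> L\<close> fixes the rest
  momentum, hence is a rotation.\<close>

lemma lorentz_decomposition:
  assumes c: "c > 0" and L: "lorentz L"
  obtains \<beta> R where "norm \<beta> < 1" "orthogonal_transformation R"
    "\<And>x. act c L x = act c (boost \<beta>) (R x)"
proof -
  \<comment> \<open>The boost that takes the rest momentum to its image under \<open>L\<close>.\<close>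
  define \<beta> where "\<beta> = (snd (L (shell c 0)) - snd (shell c 0)) /\<^sub>R (fst (L (shell c 0)) + fst (shell c 0))"
  have \<beta>: "norm \<beta> < 1" and B: "boost \<beta> (shell c 0) = L (shell c 0)"
    using boost_between[OF future_shell[OF c] lorentzD(3)[OF L future_shell[OF c]] _ \<beta>_def]
    by (auto simp: lorentzD(2)[OF L])
  define M where "M = boost (- \<beta>) \<circ> L"
  have M: "lorentz M" unfolding M_def using \<beta> by (intro lorentz_comp lorentz_boost L) auto
  have "M (shell c 0) = shell c 0" by (simp add: M_def B[symmetric] boost_inverse[OF \<beta>])
  moreover have s0: "shell c 0 = (c, 0)" using c by (simp add: shell_def energy_def)
  ultimately obtain R where R: "orthogonal_transformation R" "\<And>a x. M (a, x) = (a, R x)"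
    using rest_frame_stabilizer[OF M c] by metis
  have "L z = boost \<beta> (M z)" for z using boost_inverse[of "- \<beta>" "L z"] \<beta> by (simp add: M_def)
  then have "act c L x = act c (boost \<beta>) (R x)" for x
    by (simp add: act_def shell_def R energy_rotation)
  then show thesis using that \<beta> R by blast
qed

lemma borel_measurable_act:
  assumes "c > 0" "lorentz L" shows "act c L \<in> borel_measurable borel"
proof -
  obtain \<beta> R where R: "orthogonal_transformation R" and eq: "\<And>x. act c L x = act c (boost \<beta>) (R x)"
    using lorentz_decomposition[OF assms] by metis
  have [measurable]: "R \<in> borel_measurable borel"
    using R by (simp add: borel_measurable_linear_vec orthogonal_transformation_def)
  show ?thesis unfolding eq[abs_def] by measurable
qed

theorem lorentz_invariant_measure:
  assumes c: "c > 0" and L: "lorentz L" and [measurable]: "F \<in> borel_measurable borel"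
  shows "(LINT u|lborel. F (act c L u) / energy c u) = (LINT u|lborel. F u / energy c u)"
proof -
  obtain \<beta> R where b: "norm \<beta> < 1" and R: "orthogonal_transformation R"
    and eq: "\<And>x. act c L x = act c (boost \<beta>) (R x)"
    using lorentz_decomposition[OF c L] by metis
  have "(LINT u|lborel. F (act c L u) / energy c u)
      = (LINT u|lborel. (\<lambda>u. F (act c (boost \<beta>) u) / energy c u) (R u))"
    by (simp add: eq energy_rotation[OF R])
  also have "\<dots> = (LINT u|lborel. F (act c (boost \<beta>) u) / energy c u)"
    by (rule rotation_invariant_lborel[OF R]) measurable
  also have "\<dots> = (LINT u|lborel. F u / energy c u)"
    by (rule boost_invariant_measure[OF c b]) measurable
  finally show ?thesis .
qed

lemma borel_measurable_sgn_vec [measurable]: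
  fixes f :: "'a \<Rightarrow> real^3"
  assumes [measurable]: "f \<in> borel_measurable N"
  shows "(\<lambda>x. sgn (f x)) \<in> borel_measurable N"
  unfolding sgn_div_norm by measurable

lemma sets_borel_ball [measurable]: "ball a r \<in> sets (borel :: 'a::metric_space measure)"
  by (simp add: borel_open)

lemma sets_sphere_measure [measurable_cong, simp]: "sets sphere_measure = sets borel"
  and space_sphere_measure [simp]: "space sphere_measure = UNIV"
  by (simp_all add: sphere_measure_def)

lemma finite_sphere_measure: "finite_measure sphere_measure"
proof
  have "emeasure sphere_measure UNIV = (\<integral>\<^sup>+x. 3 * indicator (ball 0 1) x \<partial>(lborel :: (real^3) measure))"
    unfolding sphere_measure_def
    by (simp add: emeasure_distr emeasure_density)
  also have "\<dots> = 3 * emeasure lborel (ball 0 1 :: (real^3) set)"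
    by (subst nn_integral_cmult) auto
  also have "\<dots> < \<infinity>"
    using emeasure_lborel_ball_finite[of "0::real^3" 1] by (simp add: ennreal_mult_less_top)
  finally show "emeasure sphere_measure (space sphere_measure) \<noteq> \<infinity>" by simp
qed

lemma AE_sphere_norm: "AE \<omega> in sphere_measure. norm \<omega> = 1"
proof -
  have "AE x in density lborel (\<lambda>x::real^3. 3 * indicator (ball 0 1) x). norm (sgn x) = 1"
    by (subst AE_density, measurable)
      (use AE_lborel_singleton[of "0::real^3"] in \<open>auto simp: norm_sgn elim: eventually_mono\<close>)
  then show ?thesis
    unfolding sphere_measure_def by (subst AE_distr_iff) auto
qed

lemma integral_sphere_measure:
  fixes F :: "real^3 \<Rightarrow> real"
  assumes [measurable]: "F \<in> borel_measurable borel"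
  shows "(LINT \<omega>|sphere_measure. F \<omega>) = (LINT x|lborel. (3 * indicator (ball 0 1) x) * F (sgn x))"
proof -
  have "density lborel (\<lambda>x. 3 * indicator (ball 0 1) x) =
      density lborel (\<lambda>x::real^3. ennreal (3 * indicator (ball 0 1) x))"
    by (intro arg_cong2[where f=density] ext) (auto simp: indicator_def)
  then show ?thesis unfolding sphere_measure_def
    by (subst integral_distr, measurable) (simp, subst integral_density, auto)
qed

lemma rotation_invariant_sphere_measure:
  fixes F :: "real^3 \<Rightarrow> real" and R :: "real^3 \<Rightarrow> real^3"
  assumes R: "orthogonal_transformation R" and [measurable]: "F \<in> borel_measurable borel"
  shows "(LINT \<omega>|sphere_measure. F (R \<omega>)) = (LINT \<omega>|sphere_measure. F \<omega>)"
proof -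
  have lin: "linear R" using R by (simp add: orthogonal_transformation_def)
  have [measurable]: "R \<in> borel_measurable borel" by (rule borel_measurable_linear_vec[OF lin])
  have n: "norm (R x) = norm x" for x using R by (rule orthogonal_transformation_norm)
  have s: "R (sgn x) = sgn (R x)" for x by (simp add: sgn_div_norm n linear_cmul[OF lin])
  have "(LINT \<omega>|sphere_measure. F (R \<omega>))
      = (LINT x|lborel. (\<lambda>x. 3 * indicator (ball 0 1) x * F (sgn x)) (R x))"
    by (simp add: integral_sphere_measure s) (simp add: indicator_def n)
  also have "\<dots> = (LINT x|lborel. 3 * indicator (ball 0 1) x * F (sgn x))"
    by (rule rotation_invariant_lborel[OF R]) measurable
  finally show ?thesis by (simp add: integral_sphere_measure)
qed

text \<open>The angle function is measurable on \<open>{0..pi}\<close> only, while the cosine formula, taken at vectors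
  \<open>\<omega>\<close> off the unit sphere, may leave \<open>{-1..1}\<close>. There \<open>arccos\<close> is an unspecified constant, so the
  composition is still Borel on the whole line.\<close>

lemma borel_measurable_comp_arccos:
  assumes "\<sigma> \<in> borel_measurable (restrict_space borel {0..pi})"
  shows "(\<lambda>y. \<sigma> (arccos y) :: real) \<in> borel_measurable borel"
proof -
  have [measurable]: "(\<lambda>x. indicator {0..pi} x * \<sigma> x) \<in> borel_measurable borel"
    using assms by (simp add: borel_measurable_restrict_space_iff)
  have a: "(\<lambda>y. if y \<in> {-1..1} then arccos y else 0) \<in> borel_measurable borel"
    by (intro borel_measurable_continuous_on_if continuous_on_arccos') auto
  have out: "arccos y = arccos 2" if "y \<notin> {-1..1}" for y
  proof -
    have "\<not> (0 \<le> x \<and> x \<le> pi \<and> cos x = y)" "\<not> (0 \<le> x \<and> x \<le> pi \<and> cos x = 2)" for x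
      using that cos_ge_minus_one[of x] cos_le_one[of x]
      unfolding atLeastAtMost_iff by (linarith, linarith)
    then show ?thesis unfolding arccos_def by (metis (mono_tags, lifting))
  qed
  have "(\<lambda>y. \<sigma> (arccos y)) = (\<lambda>y. if y \<in> {-1..1} then
      indicator {0..pi} (if y \<in> {-1..1} then arccos y else 0) * \<sigma> (if y \<in> {-1..1} then arccos y else 0)
      else \<sigma> (arccos 2))"
  proof
    fix y :: real
    show "\<sigma> (arccos y) = (if y \<in> {-1..1} then
      indicator {0..pi} (if y \<in> {-1..1} then arccos y else 0) * \<sigma> (if y \<in> {-1..1} then arccos y else 0)
      else \<sigma> (arccos 2))"
    proof (cases "y \<in> {-1..1}")
      case True
      then show ?thesis using arccos_lbound[of y] arccos_ubound[of y] by (simp add: indicator_def)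
    next
      case False
      then show ?thesis by (simp only: out[OF False] if_False)
    qed
  qed
  also have "\<dots> \<in> borel_measurable borel"
    using a by measurable
  finally show ?thesis .
qed

section \<open>Covariance of the collision operator\<close>

locale relativistic_collision =
  fixes c \<gamma> :: real and \<sigma>\<^sub>0 :: "real \<Rightarrow> real" and M :: real
  assumes c: "c \<ge> 1" and \<gamma>: "-2 < \<gamma>" "\<gamma> \<le> 0"
    and meas_\<sigma>: "\<sigma>\<^sub>0 \<in> borel_measurable (restrict_space borel {0..pi})"
    and \<sigma>_bound: "\<And>\<theta>. \<theta> \<in> {0..pi} \<Longrightarrow> 0 \<le> \<sigma>\<^sub>0 \<theta> \<and> \<sigma>\<^sub>0 \<theta> \<le> M"
begin

lemma c_pos: "c > 0" using c by simp

abbreviation "K \<equiv> collision_kernel c \<gamma> \<sigma>\<^sub>0"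
abbreviation "Q \<equiv> collision_op c \<gamma> \<sigma>\<^sub>0"

lemma measurable_post [measurable]:
  assumes [measurable]: "v \<in> borel_measurable N" "u \<in> borel_measurable N" "w \<in> borel_measurable N"
  shows "(\<lambda>x. post_v c (v x) (u x) (w x)) \<in> borel_measurable N"
    and "(\<lambda>x. post_u c (v x) (u x) (w x)) \<in> borel_measurable N"
  unfolding post_v_def post_u_def deflection_def rel_g_def rel_s_def by measurable

lemma measurable_kernel [measurable]:
  assumes [measurable]: "v \<in> borel_measurable N" "u \<in> borel_measurable N" "w \<in> borel_measurable N"
  shows "(\<lambda>x. K (v x) (u x) (w x)) \<in> borel_measurable N"
proof -
  note [measurable] = borel_measurable_comp_arccos[OF meas_\<sigma>]
  have [measurable]: "(\<lambda>x. cos_scattering_angle c (v x) (u x) (w x)) \<in> borel_measurable N"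
    unfolding cos_scattering_angle_def rel_g_def by measurable
  have [measurable]: "(\<lambda>x. \<sigma>\<^sub>0 (scattering_angle c (v x) (u x) (w x))) \<in> borel_measurable N"
    unfolding scattering_angle_def
    by (rule measurable_compose[OF _ borel_measurable_comp_arccos[OF meas_\<sigma>]]) measurable
  show ?thesis
    unfolding collision_kernel_def moller_velocity_def cross_section_def rel_g_def rel_s_def
    by measurable
qed

text \<open>The invariance of \<open>du / energy c u\<close> moves \<open>L\<close> from the outer point to the integration
  variable \<open>u\<close>; for each \<open>u\<close> the Wigner rotation is absorbed by the sphere. Both steps are changes of
  variables that hold whether or not the integrals converge.\<close>

theorem collision_op_covariance:
  assumes L: "lorentz L" and [measurable]: "h \<in> borel_measurable borel" "f \<in> borel_measurable borel"
  shows "energy c (act c L v) * Q h f (act c L v)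
    = energy c v * Q (\<lambda>w. h (act c L w)) (\<lambda>w. f (act c L w)) v"
proof -
  define T where "T = act c L"
  have [measurable]: "T \<in> borel_measurable borel"
    unfolding T_def by (rule borel_measurable_act[OF c_pos L])
  interpret S: finite_measure sphere_measure by (rule finite_sphere_measure)
  have E: "energy c x \<noteq> 0" for x using energy_pos[OF c_pos, of x] by simp
  define G where "G = (\<lambda>w u \<omega>. energy c w * energy c u * K w u \<omega> * (h (post_u c w u \<omega>) * f (post_v c w u \<omega>) - h u * f w))"
  define \<Phi> where "\<Phi> = (\<lambda>u. LINT \<omega>|sphere_measure. G (T v) u \<omega>)"
  have [measurable]: "\<Phi> \<in> borel_measurable borel"
    unfolding \<Phi>_def G_def by measurable
  have "energy c (T v) * Q h f (T v) = (LINT u|lborel. \<Phi> u / energy c u)"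
    unfolding \<Phi>_def G_def collision_op_def integral_mult_right_zero[symmetric] integral_divide_zero[symmetric]
    using E by (simp add: mult.assoc)
  also have "\<dots> = (LINT u|lborel. \<Phi> (T u) / energy c u)"
    unfolding T_def by (rule lorentz_invariant_measure[OF c_pos L, symmetric]) measurable
  also have "\<dots> = (LINT u|lborel. (LINT \<omega>|sphere_measure. energy c v * energy c u * K v u \<omega> *
      (h (T (post_u c v u \<omega>)) * f (T (post_v c v u \<omega>)) - h (T u) * f (T v))) / energy c u)"
  proof (intro Bochner_Integration.integral_cong refl arg_cong2[where f="(/)"])
    fix u
    show "\<Phi> (T u) = (LINT \<omega>|sphere_measure. energy c v * energy c u * K v u \<omega> *
      (h (T (post_u c v u \<omega>)) * f (T (post_v c v u \<omega>)) - h (T u) * f (T v)))"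
    proof -
    obtain R where R: "orthogonal_transformation R"
      and post: "\<And>\<omega>. norm \<omega> = 1 \<Longrightarrow> post_v c (T v) (T u) (R \<omega>) = T (post_v c v u \<omega>)"
        "\<And>\<omega>. norm \<omega> = 1 \<Longrightarrow> post_u c (T v) (T u) (R \<omega>) = T (post_u c v u \<omega>)"
      and k: "\<And>\<omega>. norm \<omega> = 1 \<Longrightarrow> energy c (T v) * energy c (T u) * K (T v) (T u) (R \<omega>)
         = energy c v * energy c u * K v u \<omega>"
      unfolding T_def using collision_covariance[OF c_pos L] by metis
    have [measurable]: "R \<in> borel_measurable borel"
      using R by (simp add: borel_measurable_linear_vec orthogonal_transformation_def)
    have "\<Phi> (T u) = (LINT \<omega>|sphere_measure. G (T v) (T u) (R \<omega>))"
      unfolding \<Phi>_def G_def by (rule rotation_invariant_sphere_measure[OF R, symmetric]) measurable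
    also have "\<dots> = (LINT \<omega>|sphere_measure. energy c v * energy c u * K v u \<omega> *
      (h (T (post_u c v u \<omega>)) * f (T (post_v c v u \<omega>)) - h (T u) * f (T v)))"
    proof (rule integral_cong_AE)
      show "AE \<omega> in sphere_measure. G (T v) (T u) (R \<omega>) = energy c v * energy c u * K v u \<omega> *
        (h (T (post_u c v u \<omega>)) * f (T (post_v c v u \<omega>)) - h (T u) * f (T v))"
        using AE_sphere_norm by eventually_elim (simp add: G_def post k)
    qed (unfold G_def, measurable)
    finally show ?thesis .
    qed
  qed
  also have "\<dots> = energy c v * Q (\<lambda>w. h (T w)) (\<lambda>w. f (T w)) v"
    unfolding collision_op_def integral_mult_right_zero[symmetric] integral_divide_zero[symmetric]
    using E by (simp add: mult.assoc)
  finally show ?thesis by (simp add: T_def)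
qed

end

section \<open>Integrability of the collision kernel\<close>

lemma energy_upper: assumes "c \<ge> 1" shows "energy c x \<le> c * (1 + norm x)"
proof -
  have "c\<^sup>2 + (norm x)\<^sup>2 \<le> (c * (1 + norm x))\<^sup>2"
  proof -
    have "1 * (norm x)\<^sup>2 \<le> c\<^sup>2 * (norm x)\<^sup>2"
      using assms by (intro mult_right_mono) (auto simp: one_le_power)
    moreover have "0 \<le> c\<^sup>2 * (2 * norm x)" by simp
    moreover have "(c * (1 + norm x))\<^sup>2 = c\<^sup>2 + c\<^sup>2 * (2 * norm x) + c\<^sup>2 * (norm x)\<^sup>2"
      by (simp add: power2_eq_square algebra_simps)
    ultimately show ?thesis by argo
  qed
  then show ?thesis
    unfolding energy_def using assms by (intro real_le_lsqrt) auto
qed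

lemma energy_lower: assumes "c \<ge> 1" shows "(1 + norm x) / 2 \<le> energy c x" "1 \<le> energy c x"
proof -
  have "1 \<le> c\<^sup>2" using assms by (simp add: one_le_power)
  then have 1: "1\<^sup>2 \<le> c\<^sup>2 + (norm x)\<^sup>2" by (simp add: add_increasing2)
  then show "1 \<le> energy c x" unfolding energy_def by (rule real_le_rsqrt)
  have "0 \<le> (norm x - 1)\<^sup>2" by simp
  then have "2 * norm x \<le> (norm x)\<^sup>2 + 1" by (simp add: power2_diff)
  moreover have "((1 + norm x) / 2)\<^sup>2 \<le> (1 + 2 * norm x + (norm x)\<^sup>2) / 4"
    by (simp add: power_divide power2_sum)
  ultimately have "((1 + norm x) / 2)\<^sup>2 \<le> c\<^sup>2 + (norm x)\<^sup>2"
    using \<open>1 \<le> c\<^sup>2\<close> zero_le_power2[of "norm x"] by argo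
  then show "(1 + norm x) / 2 \<le> energy c x" unfolding energy_def by (rule real_le_rsqrt)
qed

text \<open>With \<open>A = v\<^sub>0 u\<^sub>0\<close> and \<open>B = v \<bullet> u + c\<^sup>2\<close> the difference \<open>A\<^sup>2 - B\<^sup>2\<close> is at least \<open>c\<^sup>2 \<bar>u - v\<bar>\<^sup>2\<close>, and it
  factors as \<open>(A - B) (A + B)\<close> with \<open>2 (A - B) = g\<^sup>2\<close> and \<open>A + B \<le> 2 A\<close>. This bound controls the
  singularity of the kernel at \<open>u = v\<close>.\<close>

lemma rel_g_lower:
  assumes c: "c > 0"
  shows "c\<^sup>2 * (norm (u - v))\<^sup>2 \<le> energy c v * energy c u * (rel_g c v u)\<^sup>2"
proof -
  define A where "A = energy c v * energy c u"
  define B where "B = v \<bullet> u + c\<^sup>2"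
  have "c\<^sup>2 \<le> A - v \<bullet> u" using mink_shell_ge[OF c, of v u] by (simp add: A_def mink_def shell_def)
  then have AB: "B \<le> A" by (simp add: B_def)
  have "(v \<bullet> u)\<^sup>2 \<le> (v \<bullet> v) * (u \<bullet> u)" by (rule Cauchy_Schwarz_ineq)
  moreover have "A\<^sup>2 = (c\<^sup>2 + v \<bullet> v) * (c\<^sup>2 + u \<bullet> u)" by (simp add: A_def power_mult_distrib energy_sq)
  moreover have "(norm (u - v))\<^sup>2 = v \<bullet> v + u \<bullet> u - 2 * (v \<bullet> u)"
    by (simp add: power2_norm_eq_inner inner_simps inner_commute)
  moreover have "B\<^sup>2 = (v \<bullet> u)\<^sup>2 + 2 * (c\<^sup>2 * (v \<bullet> u)) + c\<^sup>2 * c\<^sup>2"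
    by (simp add: B_def power2_eq_square algebra_simps)
  ultimately have "c\<^sup>2 * (norm (u - v))\<^sup>2 \<le> A\<^sup>2 - B\<^sup>2"
    by (simp only: ring_distribs right_diff_distrib) (simp add: mult.commute mult.left_commute)
  also have "\<dots> = (A - B) * (A + B)" by (simp add: power2_eq_square algebra_simps)
  also have "\<dots> \<le> (A - B) * (2 * A)" using AB by (intro mult_left_mono) auto
  also have "\<dots> = A * (2 * (A - B))" by simp
  also have "2 * (A - B) = (rel_g c v u)\<^sup>2"
    using AB by (simp add: rel_g_def A_def B_def algebra_simps)
  finally show ?thesis by (simp add: A_def)
qed

lemma rel_s_upper:
  assumes c: "c > 0" shows "rel_s c v u \<le> 4 * (energy c v * energy c u)"
proof -
  have "energy c (- u) = energy c u" by (simp add: energy_def)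
  then show ?thesis
    using mink_shell_ge[OF c, of v "- u"] by (simp add: rel_s_def mink_def shell_def mult.commute)
qed

text \<open>Both \<open>shell c v - shell c u\<close> and the difference of the outgoing momenta are Minkowski orthogonal
  to the total momentum. In the centre-of-mass frame they are therefore spatial vectors, of the same
  length \<open>g\<close>, and the Euclidean Cauchy-Schwarz inequality applies.\<close>

lemma cos_scattering_angle_bound:
  assumes c: "c > 0" and \<omega>: "norm \<omega> = 1"
  shows "\<bar>cos_scattering_angle c v u \<omega>\<bar> \<le> 1"
proof -
  define \<beta> where "\<beta> = com_velocity c v u"
  define g where "g = rel_g c v u"
  define m where "m = sqrt (rel_s c v u)"
  have \<beta>: "norm \<beta> < 1" and m: "m > 0" and P: "boost \<beta> (m, 0) = four_momentum c v u"
    unfolding \<beta>_def m_def by (rule com_boost[OF c])+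
  define z where "z = boost (- \<beta>) (shell c v - shell c u)"
  have Bz: "boost \<beta> z = shell c v - shell c u"
    using boost_inverse[of "- \<beta>"] \<beta> by (simp add: z_def)
  have "mink z (m, 0) = mink (shell c v - shell c u) (four_momentum c v u)"
    using mink_boost[OF \<beta>, of z "(m, 0)"] by (simp add: Bz P)
  also have "\<dots> = 0"
    by (simp add: four_momentum_def mink_simps mink_shell_self mink_sym[of "shell c u" "shell c v"])
  finally have z: "fst z = 0" using m by (simp add: mink_def)
  have g2: "g\<^sup>2 = snd z \<bullet> snd z"
    using mink_boost[OF \<beta>, of z z] rel_g_sq[OF c, of v u] by (simp add: Bz g_def) (simp add: mink_def z)
  then have ng: "norm (snd z) = g"
    using rel_g_nonneg[OF c, of v u] by (simp add: norm_eq_sqrt_inner g_def[symmetric] real_sqrt_unique)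
  have "shell c (post_v c v u \<omega>) - shell c (post_u c v u \<omega>) = g *\<^sub>R boost \<beta> (0, \<omega>)"
    unfolding shell_post[OF c \<omega>] by (simp add: g_def \<beta>_def scaleR_add_left[symmetric])
  then have cos: "cos_scattering_angle c v u \<omega> = g * (snd z \<bullet> \<omega>) / g\<^sup>2"
    unfolding cos_angle_mink by (simp add: Bz[symmetric] mink_simps mink_boost[OF \<beta>] g_def) (simp add: mink_def z)
  have "\<bar>snd z \<bullet> \<omega>\<bar> \<le> g" using Cauchy_Schwarz_ineq2[of "snd z" \<omega>] by (simp add: \<omega> ng)
  then show ?thesis unfolding cos by (cases "g = 0") (auto simp: power2_eq_square divide_simps abs_mult)
qed

text \<open>By conservation of energy at least one outgoing momentum is of the order of \<open>u\<close>, so a product of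
  decaying functions of the two outgoing momenta decays in \<open>u\<close>.\<close>

lemma post_product_lower:
  assumes c: "c \<ge> 1" and \<omega>: "norm \<omega> = 1"
  shows "1 + norm u \<le> 4 * c * ((1 + norm (post_u c v u \<omega>)) * (1 + norm (post_v c v u \<omega>)))"
proof -
  define a where "a = norm (post_u c v u \<omega>)"
  define b where "b = norm (post_v c v u \<omega>)"
  have c0: "c > 0" using c by simp
  have "energy c (post_v c v u \<omega>) + energy c (post_u c v u \<omega>) = energy c v + energy c u"
    using arg_cong2[OF shell_post[OF c0 \<omega>, of v u], of "\<lambda>x y. fst (x + y)"]
    by (simp add: four_momentum_def shell_def)
  then have "energy c v + energy c u \<le> energy c (post_v c v u \<omega>) + energy c (post_u c v u \<omega>)" by simp
  moreover have "(1 + norm u) / 2 \<le> energy c u" "1 \<le> energy c v" using energy_lower[OF c] by auto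
  moreover have "energy c (post_v c v u \<omega>) \<le> c * (1 + b)" "energy c (post_u c v u \<omega>) \<le> c * (1 + a)"
    using energy_upper[OF c] by (auto simp: a_def b_def)
  ultimately have "1 + norm u \<le> 2 * (c * (1 + b) + c * (1 + a))" by argo
  also have "\<dots> = c * (2 * ((1 + b) + (1 + a)))" by (simp add: algebra_simps)
  also have "\<dots> \<le> c * (4 * ((1 + a) * (1 + b)))"
    using c by (intro mult_left_mono) (auto simp: a_def b_def algebra_simps)
  finally show ?thesis by (simp add: a_def b_def mult.assoc)
qed

lemma dyadic_bracket:
  fixes x :: real assumes "1 \<le> x" obtains n :: nat where "2 ^ n \<le> x" "x < 2 ^ Suc n"
proof -
  define n where "n = (LEAST n. x < 2 ^ n)"
  have ex: "\<exists>n. x < 2 ^ n" by (rule real_arch_pow) simp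
  have n: "x < 2 ^ n" unfolding n_def by (rule LeastI_ex[OF ex])
  then obtain k where k: "n = Suc k" using assms by (cases n) auto
  have "\<not> x < 2 ^ k" using not_less_Least[of k "\<lambda>n. x < 2 ^ n"] k by (simp add: n_def)
  then show thesis using that[of k] n k by simp
qed

text \<open>A replacement for polar coordinates: bounding \<open>f\<close> by constants on countably many balls reduces
  integrability to the convergence of a numerical series, here always a geometric one.\<close>

lemma integrable_dyadic:
  fixes f :: "real^3 \<Rightarrow> real" and a r :: "nat \<Rightarrow> real"
  assumes [measurable]: "f \<in> borel_measurable borel"
    and f: "\<And>x. 0 \<le> f x" and a: "\<And>n. 0 \<le> a n" and r: "\<And>n. 0 \<le> r n"
    and cover: "\<And>x. f x \<noteq> 0 \<Longrightarrow> \<exists>n. x \<in> ball z (r n) \<and> f x \<le> a n"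
    and summable: "summable (\<lambda>n. a n * r n ^ 3)"
  shows "integrable lborel f"
proof (rule integrableI_nonneg)
  have "(\<integral>\<^sup>+x. ennreal (f x) \<partial>lborel) \<le> (\<integral>\<^sup>+x. (\<Sum>n. ennreal (a n) * indicator (ball z (r n)) x) \<partial>lborel)"
  proof (rule nn_integral_mono)
    fix x
    show "ennreal (f x) \<le> (\<Sum>n. ennreal (a n) * indicator (ball z (r n)) x)"
    proof (cases "f x = 0")
      case False
      then obtain n where n: "x \<in> ball z (r n)" "f x \<le> a n" using cover by blast
      have "ennreal (f x) \<le> ennreal (a n) * indicator (ball z (r n)) x"
        using n by (simp add: ennreal_leI)
      also have "\<dots> = (\<Sum>i\<in>{n}. ennreal (a i) * indicator (ball z (r i)) x)"
        by (simp only: sum.insert sum.empty finite.emptyI empty_iff not_False_eq_True add_0_right)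
      also have "\<dots> \<le> (\<Sum>i. ennreal (a i) * indicator (ball z (r i)) x)"
        by (rule sum_le_suminf) auto
      finally show ?thesis .
    qed simp
  qed
  also have "\<dots> = (\<Sum>n. ennreal (a n) * emeasure lborel (ball z (r n)))"
    by (subst nn_integral_suminf) (auto simp: nn_integral_cmult)
  also have "\<dots> = (\<Sum>n. ennreal (unit_ball_vol 3 * (a n * r n ^ 3)))"
    using a r by (intro suminf_cong) (simp add: emeasure_ball ennreal_mult[symmetric] mult_ac)
  also have "\<dots> \<noteq> top"
  proof (rule ennreal_suminf_neq_top)
    show "summable (\<lambda>n. unit_ball_vol 3 * (a n * r n ^ 3))" by (rule summable_mult[OF summable])
    show "0 \<le> unit_ball_vol 3 * (a n * r n ^ 3)" for n using a r by simp
  qed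
  then have "(\<Sum>n. ennreal (unit_ball_vol 3 * (a n * r n ^ 3))) < \<infinity>" by (simp add: less_top)
  finally show "(\<integral>\<^sup>+x. ennreal (f x) \<partial>lborel) < \<infinity>" .
qed (use f in auto)

lemma integrable_tail: "integrable lborel (\<lambda>u::real^3. 1 / (sqrt (1 + norm u) * (1 + norm u) ^ 3))"
proof (rule integrable_dyadic[where z = 0 and r = "\<lambda>n. 2 ^ Suc n" and a = "\<lambda>n. 1 / (sqrt 2 ^ n * 8 ^ n)"])
  fix u :: "real^3"
  obtain n where n: "2 ^ n \<le> 1 + norm u" "1 + norm u < 2 ^ Suc n"
    using dyadic_bracket[of "1 + norm u"] by auto
  have "sqrt 2 ^ n \<le> sqrt (1 + norm u)" using n(1) by (simp add: real_sqrt_power[symmetric])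
  moreover have "(8::real) ^ n \<le> (1 + norm u) ^ 3"
    using power_mono[OF n(1), of 3] by (simp add: power_mult[symmetric] mult.commute[of n] power_mult)
  ultimately have "1 / (sqrt (1 + norm u) * (1 + norm u) ^ 3) \<le> 1 / (sqrt 2 ^ n * 8 ^ n)"
    by (intro divide_left_mono mult_mono mult_pos_pos zero_less_power)
      (auto simp: add_pos_nonneg)
  then show "\<exists>n. u \<in> ball 0 (2 ^ Suc n) \<and> 1 / (sqrt (1 + norm u) * (1 + norm u) ^ 3) \<le> 1 / (sqrt 2 ^ n * 8 ^ n)"
    using n(2) by (intro exI[of _ n]) auto
next
  have "summable (\<lambda>n. 8 * (1 / sqrt 2) ^ n :: real)"
    by (intro summable_mult summable_geometric) simp
  moreover have "1 / (sqrt 2 ^ n * 8 ^ n) * (2 ^ Suc n) ^ 3 = 8 * (1 / sqrt 2) ^ n" for n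
  proof -
    have "((2::real) ^ Suc n) ^ 3 = 8 * 8 ^ n"
      by (simp add: power_mult_distrib power_mult[symmetric] mult.commute[of n] power_mult)
    then show ?thesis by (simp add: power_divide)
  qed
  ultimately show "summable (\<lambda>n. 1 / (sqrt 2 ^ n * 8 ^ n) * (2 ^ Suc n) ^ 3 :: real)" by simp
qed auto

lemma integrable_inverse_square: "integrable lborel (\<lambda>u::real^3. indicator (ball v 1) u / (norm (u - v))\<^sup>2)"
proof (rule integrable_dyadic[where z = v and r = "\<lambda>n. 2 * (1/2) ^ n" and a = "\<lambda>n. 4 * 4 ^ n"])
  fix u :: "real^3" assume nz: "indicator (ball v 1) u / (norm (u - v))\<^sup>2 \<noteq> (0::real)"
  define t where "t = norm (u - v)"
  have t: "0 < t" "t < 1" using nz by (auto simp: t_def indicator_def dist_norm norm_minus_commute split: if_splits)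
  obtain n where n: "2 ^ n \<le> 1 / t" "1 / t < 2 ^ Suc n" using dyadic_bracket[of "1 / t"] t by auto
  have "t \<le> (1/2) ^ n" using n(1) t by (simp add: power_divide divide_simps mult.commute)
  then have "t < 2 * (1/2) ^ n" by (smt (verit) t)
  then have 1: "u \<in> ball v (2 * (1/2) ^ n)" by (simp add: t_def dist_norm norm_minus_commute)
  have "(1 / t)\<^sup>2 \<le> (2 ^ Suc n)\<^sup>2" using n(2) t by (intro power_mono) auto
  also have "\<dots> = 4 * 4 ^ n" by (simp add: power_mult_distrib power_mult[symmetric] mult.commute[of n] power_mult)
  finally have "1 / t\<^sup>2 \<le> 4 * 4 ^ n" by (simp add: power_divide)
  moreover have "indicator (ball v 1) u / (norm (u - v))\<^sup>2 \<le> 1 / t\<^sup>2"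
    by (simp add: t_def indicator_def)
  ultimately show "\<exists>n. u \<in> ball v (2 * (1/2) ^ n) \<and> indicator (ball v 1) u / (norm (u - v))\<^sup>2 \<le> (4 * 4 ^ n::real)"
    using 1 by (intro exI[of _ n]) auto
next
  have "summable (\<lambda>n. 32 * (1 / 2) ^ n :: real)"
    by (intro summable_mult summable_geometric) simp
  moreover have "4 * 4 ^ n * (2 * (1/2) ^ n) ^ 3 = 32 * (1 / 2 :: real) ^ n" for n
    by (induction n) (simp_all add: power3_eq_cube)
  ultimately show "summable (\<lambda>n. 4 * 4 ^ n * (2 * (1/2) ^ n) ^ 3 :: real)" by simp
qed auto

text \<open>Up to a factor depending on \<open>v\<close>, the kernel is bounded by the sum in brackets, and
  \<open>(1 + norm u) ^ 3\<close> in the denominator is the decay of the functions it is multiplied with. The powers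
  are \<open>-7/2\<close> at infinity and \<open>-2\<close> at \<open>v\<close>, on either side of the critical power \<open>-3\<close>.\<close>

definition weight :: "real^3 \<Rightarrow> real^3 \<Rightarrow> real" where
  "weight v u = (1 / sqrt (1 + norm u) + sqrt (1 + norm u) / (norm (u - v))\<^sup>2) / (1 + norm u) ^ 3"

lemma weight_nonneg: "0 \<le> weight v u"
  by (simp add: weight_def)

lemma integrable_weight: "integrable lborel (weight v)"
proof (rule Bochner_Integration.integrable_bound)
  let ?w = "\<lambda>u::real^3. 1 / (sqrt (1 + norm u) * (1 + norm u) ^ 3)"
  let ?s = "\<lambda>u::real^3. indicator (ball v 1) u / (norm (u - v))\<^sup>2"
  show "integrable lborel (\<lambda>u. (1 + (2 + norm v)\<^sup>2) * ?w u + ?s u)"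
    by (intro Bochner_Integration.integrable_add integrable_mult_right integrable_tail integrable_inverse_square)
  show "weight v \<in> borel_measurable lborel" unfolding weight_def[abs_def] by measurable
  show "AE u in lborel. norm (weight v u) \<le> norm ((1 + (2 + norm v)\<^sup>2) * ?w u + ?s u)"
  proof (rule AE_I2)
    fix u :: "real^3"
    define y where "y = 1 + norm u"
    have y: "y \<ge> 1" by (simp add: y_def)
    then have y: "y \<ge> 1" "sqrt y \<ge> 1" "sqrt y > 0" by auto
    have sy: "sqrt y * sqrt y = y" using y by simp
    have "sqrt y / (norm (u - v))\<^sup>2 / y ^ 3 \<le> (2 + norm v)\<^sup>2 * ?w u + ?s u"
    proof (cases "u \<in> ball v 1")
      case True
      have "sqrt y \<le> y ^ 3"
      proof -
        have "sqrt y * 1 \<le> sqrt y * sqrt y" using y by (intro mult_left_mono) auto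
        also have "\<dots> = y ^ 1" using sy by simp
        also have "\<dots> \<le> y ^ 3" using y by (intro power_increasing) auto
        finally show ?thesis by simp
      qed
      then have "sqrt y / y ^ 3 \<le> 1" using y by (simp add: divide_simps)
      then have "sqrt y / y ^ 3 / (norm (u - v))\<^sup>2 \<le> 1 / (norm (u - v))\<^sup>2" by (intro divide_right_mono) auto
      then have "sqrt y / (norm (u - v))\<^sup>2 / y ^ 3 \<le> ?s u" using True by (simp add: mult.commute)
      moreover have "0 \<le> (2 + norm v)\<^sup>2 * ?w u" by simp
      ultimately show ?thesis by linarith
    next
      case False
      define t where "t = norm (u - v)"
      have t: "t \<ge> 1" using False by (simp add: t_def dist_norm norm_minus_commute)
      have "norm u \<le> t + norm v" using norm_triangle_ineq[of "u - v" v] by (simp add: t_def)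
      also have "\<dots> \<le> t + norm v * t" using t by (simp add: mult_le_cancel_left1)
      finally have "y \<le> (2 + norm v) * t" using t by (simp add: y_def algebra_simps)
      then have "y * 1 \<le> (2 + norm v)\<^sup>2 * t\<^sup>2"
        using y power_mono[of y "(2 + norm v) * t" 2] self_le_power[of y 2] by (simp add: power_mult_distrib)
      then have "sqrt y / t\<^sup>2 \<le> (2 + norm v)\<^sup>2 / sqrt y"
        using y t sy by (simp add: divide_simps mult.commute)
      then have "sqrt y / t\<^sup>2 / y ^ 3 \<le> (2 + norm v)\<^sup>2 / sqrt y / y ^ 3" using y by (intro divide_right_mono) auto
      then show ?thesis using False by (simp add: t_def y_def)
    qed
    then have "weight v u \<le> (1 + (2 + norm v)\<^sup>2) * ?w u + ?s u"
      by (simp add: weight_def y_def add_divide_distrib distrib_right)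
    then show "norm (weight v u) \<le> norm ((1 + (2 + norm v)\<^sup>2) * ?w u + ?s u)"
      using weight_nonneg[of v u] by simp
  qed
qed

context relativistic_collision begin

text \<open>For \<open>-2 < \<gamma> \<le> 0\<close> one has \<open>g powr \<gamma> \<le> 1 + 1 / g\<^sup>2\<close>, and \<open>rel_g_lower\<close> turns \<open>1 / g\<^sup>2\<close> into
  \<open>v\<^sub>0 u\<^sub>0 / (c\<^sup>2 \<bar>u - v\<bar>\<^sup>2)\<close>. The remaining factor \<open>sqrt s / (v\<^sub>0 u\<^sub>0)\<close> is of order \<open>1 / sqrt (v\<^sub>0 u\<^sub>0)\<close>.\<close>

lemma kernel_bound:
  obtains C where "0 \<le> C"
    "\<And>u \<omega>. norm \<omega> = 1 \<Longrightarrow> \<bar>K v u \<omega>\<bar> \<le> C * (1 / sqrt (1 + norm u) + sqrt (1 + norm u) / (norm (u - v))\<^sup>2)"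
proof
  have M: "0 \<le> M" using \<sigma>_bound[of 0] pi_ge_zero by auto
  define C where "C = M * c * (1 + sqrt (energy c v * c))"
  show "0 \<le> M * c * (1 + sqrt (energy c v * c))"
    using M c energy_pos[OF c_pos, of v] by (intro mult_nonneg_nonneg add_nonneg_nonneg) auto
  fix u \<omega> :: "real^3" assume \<omega>: "norm \<omega> = 1"
  define g where "g = rel_g c v u"
  define A where "A = energy c v * energy c u"
  define y where "y = 1 + norm u"
  define d where "d = (norm (u - v))\<^sup>2"
  have y: "y \<ge> 1" by (simp add: y_def)
  have g0: "g \<ge> 0" by (simp add: g_def rel_g_nonneg c_pos)
  have "\<bar>cos_scattering_angle c v u \<omega>\<bar> \<le> 1" by (rule cos_scattering_angle_bound[OF c_pos \<omega>])
  then have "scattering_angle c v u \<omega> \<in> {0..pi}"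
    by (simp add: scattering_angle_def arccos_lbound arccos_ubound abs_le_iff)
  note s = \<sigma>_bound[OF this]
  have A: "y / 2 \<le> A" "A \<le> energy c v * (c * y)" "A > 0"
  proof -
    have "1 * ((1 + norm u) / 2) \<le> energy c v * energy c u"
      using energy_lower[OF c] energy_pos[OF c_pos, of v] by (intro mult_mono) auto
    then show "y / 2 \<le> A" by (simp add: A_def y_def)
    then show "A > 0" using y by linarith
    show "A \<le> energy c v * (c * y)" unfolding A_def y_def
      using energy_upper[OF c] energy_pos[OF c_pos, of v] by (intro mult_left_mono) auto
  qed
  have sA: "sqrt A > 0" "sqrt A * sqrt A = A" using A by auto
  have s4: "sqrt (rel_s c v u) \<le> 2 * sqrt A"
    using rel_s_upper[OF c_pos, of v u] real_sqrt_le_mono[of "rel_s c v u" "4 * A"]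
    by (simp add: A_def real_sqrt_mult)
  have gd: "c\<^sup>2 * d \<le> A * g\<^sup>2" using rel_g_lower[OF c_pos, of u v] by (simp add: d_def A_def g_def)
  have gg: "g * g powr (\<gamma> - 1) \<le> 1 + A / d"
  proof (cases "g = 0")
    case True then show ?thesis using A by (simp add: d_def)
  next
    case False
    then have g: "g > 0" using g0 by simp
    then have "g * g powr (\<gamma> - 1) = g powr \<gamma>" by (simp add: powr_diff)
    also have "\<dots> \<le> 1 + 1 / g\<^sup>2"
    proof (cases "g \<ge> 1")
      case True
      then have "g powr \<gamma> \<le> g powr 0" using \<gamma> by (intro powr_mono) auto
      then show ?thesis using g by (simp add: add_increasing2)
    next
      case False
      then have "g powr \<gamma> \<le> g powr (-2)" using \<gamma> g by (intro powr_mono') auto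
      also have "\<dots> = 1 / g\<^sup>2" using g by (simp add: powr_minus_divide powr_numeral)
      finally show ?thesis by simp
    qed
    also have "1 / g\<^sup>2 \<le> A / d"
    proof (cases "d = 0")
      case True
      then have "u = v" by (simp add: d_def)
      then have "g = 0" by (simp add: g_def rel_g_mink mink_shell_self)
      then show ?thesis using g by simp
    next
      case False
      then have d: "d > 0" by (simp add: d_def)
      have "1 * d \<le> c\<^sup>2 * d" using c d by (intro mult_right_mono) (auto simp: one_le_power)
      then have "d \<le> A * g\<^sup>2" using gd by linarith
      then show ?thesis using g d by (simp add: divide_simps mult.commute)
    qed
    finally show ?thesis by simp
  qed
  have Keq: "K v u \<omega> = (c * sqrt (rel_s c v u) / (4 * A)) * (g * g powr (\<gamma> - 1)) * \<sigma>\<^sub>0 (scattering_angle c v u \<omega>)"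
    using g0 by (simp add: collision_kernel_def moller_velocity_def cross_section_def g_def[symmetric] A_def mult_ac)
  have "K v u \<omega> \<ge> 0" unfolding Keq using c A g0 s com_boost(1)[OF c_pos, of v u]
    by (intro mult_nonneg_nonneg divide_nonneg_nonneg) auto
  moreover have "K v u \<omega> \<le> (c * (2 * sqrt A) / (4 * A)) * (1 + A / d) * M"
    unfolding Keq using c A g0 s s4 gg com_boost(1)[OF c_pos, of v u]
    by (intro mult_mono divide_right_mono mult_left_mono mult_nonneg_nonneg divide_nonneg_nonneg add_nonneg_nonneg)
      (auto simp: d_def)
  moreover have "(c * (2 * sqrt A) / (4 * A)) * (1 + A / d) * M = M * c * (1 / (2 * sqrt A) + sqrt A / (2 * d))"
  proof -
    have "(c * (2 * r) / (4 * (r * r))) * (1 + (r * r) / d) * M = M * c * (1 / (2 * r) + r / (2 * d))"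
      if "r > 0" for r
      using that by (cases "d = 0") (simp_all add: field_simps)
    from this[OF sA(1)] show ?thesis unfolding sA(2) .
  qed
  moreover have "\<dots> \<le> M * c * ((1 + sqrt (energy c v * c)) * (1 / sqrt y + sqrt y / d))"
  proof (intro mult_left_mono)
    have q: "0 \<le> sqrt (energy c v * c)" using c energy_pos[OF c_pos, of v] by simp
    have "sqrt y \<le> sqrt (4 * A)" using A y by (intro real_sqrt_le_mono) linarith
    then have "sqrt y \<le> 2 * sqrt A" by (simp add: real_sqrt_mult)
    then have 1: "1 / (2 * sqrt A) \<le> 1 / sqrt y" using y A(3) by (intro divide_left_mono mult_pos_pos) auto
    have "sqrt A \<le> sqrt (energy c v * c) * sqrt y"
      using A real_sqrt_le_mono[of A "energy c v * c * y"] by (simp add: real_sqrt_mult mult.assoc)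
    then have "sqrt A \<le> 2 * (sqrt (energy c v * c) * sqrt y)" using sA by linarith
    then have "sqrt A / (2 * d) \<le> 2 * (sqrt (energy c v * c) * sqrt y) / (2 * d)"
      by (intro divide_right_mono) (auto simp: d_def)
    then have 2: "sqrt A / (2 * d) \<le> sqrt (energy c v * c) * (sqrt y / d)" by simp
    have 3: "0 \<le> sqrt y / d" "0 \<le> sqrt (energy c v * c) * (1 / sqrt y)" using y q by (auto simp: d_def)
    show "1 / (2 * sqrt A) + sqrt A / (2 * d) \<le> (1 + sqrt (energy c v * c)) * (1 / sqrt y + sqrt y / d)"
      using 1 2 3 by (simp only: distrib_left distrib_right mult_1_left)
  qed (use M c in auto)
  ultimately show "\<bar>K v u \<omega>\<bar> \<le> M * c * (1 + sqrt (energy c v * c)) *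
      (1 / sqrt (1 + norm u) + sqrt (1 + norm u) / (norm (u - v))\<^sup>2)"
    unfolding y_def d_def by (simp only: abs_of_nonneg mult.assoc)
qed

end

section \<open>Differentiation under the collision integral\<close>

definition decays :: "real \<Rightarrow> (real^3 \<Rightarrow> real) \<Rightarrow> bool" where
  "decays C p \<longleftrightarrow> p \<in> borel_measurable borel \<and> (\<forall>x. \<bar>p x\<bar> \<le> C / (1 + norm x) ^ 3)"

lemma decays_measurable [measurable_dest]: "decays C p \<Longrightarrow> p \<in> borel_measurable borel"
  and decays_bound: "decays C p \<Longrightarrow> \<bar>p x\<bar> \<le> C / (1 + norm x) ^ 3"
  by (auto simp: decays_def)

lemma decays_nonneg: "decays C p \<Longrightarrow> 0 \<le> C"
  using decays_bound[of C p 0] by simp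

text \<open>The hypotheses on a parametrised family under which the collision integral can be differentiated
  at parameter \<open>0\<close>. The Lipschitz condition compares with parameter \<open>0\<close> only and replaces a bound on
  derivatives at nearby parameters.\<close>

definition tame :: "('e::real_normed_vector \<Rightarrow> real^3 \<Rightarrow> real) \<Rightarrow> (real^3 \<Rightarrow> 'e \<Rightarrow> real) \<Rightarrow> real \<Rightarrow> real \<Rightarrow> bool" where
  "tame p P \<delta> C \<longleftrightarrow> \<delta> > 0 \<and>
    (\<forall>a. norm a < \<delta> \<longrightarrow> decays C (p a) \<and> decays (C * norm a) (\<lambda>x. p a x - p 0 x)) \<and>
    (\<forall>e. decays (C * norm e) (\<lambda>x. P x e)) \<and>
    (\<forall>x. ((\<lambda>a. p a x) has_derivative P x) (at 0))"

context relativistic_collision begin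

definition integrand :: "(real^3 \<Rightarrow> real) \<Rightarrow> (real^3 \<Rightarrow> real) \<Rightarrow> real^3 \<Rightarrow> (real^3) \<times> (real^3) \<Rightarrow> real" where
  "integrand p q v z = K v (fst z) (snd z) *
     (p (post_u c v (fst z) (snd z)) * q (post_v c v (fst z) (snd z)) - p (fst z) * q v)"

abbreviation "N \<equiv> (lborel :: (real^3) measure) \<Otimes>\<^sub>M sphere_measure"

lemma pair_sigma_finite_N: "pair_sigma_finite (lborel :: (real^3) measure) sphere_measure"
proof -
  interpret S: finite_measure sphere_measure by (rule finite_sphere_measure)
  show ?thesis by unfold_locales
qed

lemma sets_N [measurable_cong]: "sets N = sets (borel \<Otimes>\<^sub>M borel)"
  by (intro sets_pair_measure_cong) simp_all

lemma measurable_integrand [measurable]: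
  assumes [measurable]: "p \<in> borel_measurable borel" "q \<in> borel_measurable borel"
  shows "integrand p q v \<in> borel_measurable N"
  unfolding integrand_def[abs_def] by measurable

lemma AE_N_norm: "AE z in N. norm (snd z) = 1"
proof -
  interpret P: pair_sigma_finite "lborel :: (real^3) measure" sphere_measure
    by (rule pair_sigma_finite_N)
  show ?thesis
  proof (rule P.AE_pair_measure)
    show "{z \<in> space N. norm (snd z) = 1} \<in> sets N" by measurable
    show "AE u in lborel. AE \<omega> in sphere_measure. norm (snd (u, \<omega>)) = 1"
      using AE_sphere_norm by simp
  qed
qed

lemma integrable_weight_N: "integrable N (\<lambda>z. weight v (fst z))"
proof -
  interpret S: finite_measure sphere_measure by (rule finite_sphere_measure)
  interpret P: pair_sigma_finite "lborel :: (real^3) measure" sphere_measure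
    by (rule pair_sigma_finite_N)
  have [measurable]: "weight v \<in> borel_measurable lborel"
    using integrable_weight by (rule borel_measurable_integrable)
  show ?thesis
  proof (rule P.Fubini_integrable)
    show "(\<lambda>z. weight v (fst z)) \<in> borel_measurable N" by measurable
    show "integrable lborel (\<lambda>u. LINT \<omega>|sphere_measure. norm (weight v (fst (u, \<omega>))))"
      using integrable_weight by (simp add: integrable_norm)
    show "AE u in lborel. integrable sphere_measure (\<lambda>\<omega>. weight v (fst (u, \<omega>)))" by simp
  qed
qed

text \<open>The bound is bilinear in the decay constants. Therefore it also bounds increments and
  derivatives of the integrand, where one of the constants is proportional to the parameter.\<close>

lemma integrand_bound:
  obtains A where "0 \<le> A"
    "\<And>p q C D. decays C p \<Longrightarrow> decays D q \<Longrightarrow>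
      AE z in N. \<bar>integrand p q v z\<bar> \<le> A * C * D * weight v (fst z)"
proof -
  obtain B where B: "0 \<le> B"
    and K: "\<And>u \<omega>. norm \<omega> = 1 \<Longrightarrow>
      \<bar>K v u \<omega>\<bar> \<le> B * (1 / sqrt (1 + norm u) + sqrt (1 + norm u) / (norm (u - v))\<^sup>2)"
    by (rule kernel_bound[of v]) blast
  define A where "A = B * ((4 * c) ^ 3 + 1)"
  show thesis
  proof (rule that)
    show "0 \<le> A" using B c by (simp add: A_def)
    fix p q C D assume p: "decays C p" and q: "decays D q"
    have CD: "0 \<le> C" "0 \<le> D" using p q by (auto dest: decays_nonneg)
    show "AE z in N. \<bar>integrand p q v z\<bar> \<le> A * C * D * weight v (fst z)"
      using AE_N_norm
    proof eventually_elim
      fix z :: "(real^3) \<times> (real^3)" assume \<omega>: "norm (snd z) = 1"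
      define u where "u = fst z"
      define a where "a = 1 + norm (post_u c v u (snd z))"
      define b where "b = 1 + norm (post_v c v u (snd z))"
      define y where "y = 1 + norm u"
      have pos: "a > 0" "b > 0" "y > 0" by (auto simp: a_def b_def y_def add_pos_nonneg)
      have "y \<le> 4 * c * (a * b)" using post_product_lower[OF c \<omega>] by (simp add: a_def b_def y_def)
      then have "y ^ 3 \<le> (4 * c * (a * b)) ^ 3" using pos by (intro power_mono) auto
      then have y3: "1 / (a ^ 3 * b ^ 3) \<le> (4 * c) ^ 3 / y ^ 3"
        using pos by (simp add: divide_simps power_mult_distrib mult.commute)
      have "\<bar>p (post_u c v u (snd z)) * q (post_v c v u (snd z))\<bar> \<le> (C / a ^ 3) * (D / b ^ 3)"
        unfolding abs_mult a_def b_def using p q CD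
        by (intro mult_mono decays_bound) (auto intro: divide_nonneg_nonneg)
      also have "\<dots> = C * D * (1 / (a ^ 3 * b ^ 3))" by simp
      also have "\<dots> \<le> C * D * ((4 * c) ^ 3 / y ^ 3)" using CD y3 by (intro mult_left_mono) auto
      finally have 1: "\<bar>p (post_u c v u (snd z)) * q (post_v c v u (snd z))\<bar> \<le> C * D * ((4 * c) ^ 3 / y ^ 3)" .
      have "D / (1 + norm v) ^ 3 \<le> D / 1" using CD by (intro divide_left_mono) (auto simp: one_le_power add_pos_nonneg)
      then have "\<bar>q v\<bar> \<le> D" using decays_bound[OF q, of v] by simp
      then have "\<bar>p u * q v\<bar> \<le> (C / y ^ 3) * D"
        unfolding abs_mult y_def using p CD
        by (intro mult_mono decays_bound) (auto intro: divide_nonneg_nonneg)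
      then have "\<bar>p (post_u c v u (snd z)) * q (post_v c v u (snd z)) - p u * q v\<bar>
          \<le> C * D * ((4 * c) ^ 3 / y ^ 3) + (C / y ^ 3) * D"
        using 1 by (intro order_trans[OF abs_triangle_ineq4]) (rule add_mono)
      also have "\<dots> = C * D * ((4 * c) ^ 3 + 1) / y ^ 3" by (simp add: add_divide_distrib algebra_simps)
      finally have "\<bar>integrand p q v z\<bar> \<le> (B * (1 / sqrt y + sqrt y / (norm (u - v))\<^sup>2)) * (C * D * ((4 * c) ^ 3 + 1) / y ^ 3)"
        unfolding integrand_def u_def[symmetric] abs_mult y_def using K[OF \<omega>] B
        by (intro mult_mono) (auto intro!: mult_nonneg_nonneg add_nonneg_nonneg)
      also have "\<dots> = A * C * D * weight v (fst z)"
        by (simp add: weight_def A_def y_def u_def)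
      finally show "\<bar>integrand p q v z\<bar> \<le> A * C * D * weight v (fst z)" .
    qed
  qed
qed

lemma integrable_integrand:
  assumes p: "decays C p" and q: "decays D q"
  shows "integrable N (integrand p q v)"
proof -
  obtain A where "0 \<le> A" and bound: "\<And>p q C D. decays C p \<Longrightarrow> decays D q \<Longrightarrow>
      AE z in N. \<bar>integrand p q v z\<bar> \<le> A * C * D * weight v (fst z)"
    by (rule integrand_bound[of v]) blast
  note A = bound[OF p q]
  note [measurable] = decays_measurable[OF p] decays_measurable[OF q]
  show ?thesis
  proof (rule Bochner_Integration.integrable_bound)
    show "integrable N (\<lambda>z. A * C * D * weight v (fst z))"
      by (intro integrable_mult_right integrable_weight_N)
    show "integrand p q v \<in> borel_measurable N" by measurable
    show "AE z in N. norm (integrand p q v z) \<le> norm (A * C * D * weight v (fst z))"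
      using A by eventually_elim (auto intro: order_trans[OF _ abs_ge_self])
  qed
qed

lemma collision_op_eq:
  assumes "decays C p" "decays D q"
  shows "Q p q v = (LINT z|N. integrand p q v z)"
proof -
  interpret P: pair_sigma_finite "lborel :: (real^3) measure" sphere_measure
    by (rule pair_sigma_finite_N)
  have "Q p q v = (LINT u|lborel. LINT \<omega>|sphere_measure. integrand p q v (u, \<omega>))"
    by (simp add: collision_op_def integrand_def)
  then show ?thesis
    using P.integral_fst'[OF integrable_integrand[OF assms, of v]] by simp
qed

lemma integrand_add_left: "integrand (\<lambda>x. p x + p' x) q v z = integrand p q v z + integrand p' q v z"
  and integrand_add_right: "integrand p (\<lambda>x. q x + q' x) v z = integrand p q v z + integrand p q' v z"
  and integrand_diff_left: "integrand (\<lambda>x. p x - p' x) q v z = integrand p q v z - integrand p' q v z"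
  and integrand_diff_right: "integrand p (\<lambda>x. q x - q' x) v z = integrand p q v z - integrand p q' v z"
  and integrand_scale_left: "integrand (\<lambda>x. r * p x) q v z = r * integrand p q v z"
  and integrand_scale_right: "integrand p (\<lambda>x. r * q x) v z = r * integrand p q v z"
  by (simp_all add: integrand_def algebra_simps)

text \<open>Product rule under the integral sign. The difference quotients converge pointwise and are
  dominated by a multiple of \<open>weight v\<close>, by \<open>integrand_bound\<close> applied to each factor separately. The
  singularity of the weight stays at the fixed point \<open>v\<close>; this is why the parameter sits in the functions
  and not in the point at which the collision operator is evaluated.\<close>

theorem collision_op_has_derivative:
  fixes p q :: "'e::euclidean_space \<Rightarrow> real^3 \<Rightarrow> real"
  assumes p: "tame p P \<delta>\<^sub>1 C" and q: "tame q R \<delta>\<^sub>2 D"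
  shows "((\<lambda>a. Q (p a) (q a) v) has_derivative
     (\<lambda>e. Q (\<lambda>x. P x e) (q 0) v + Q (p 0) (\<lambda>x. R x e) v)) (at 0)"
proof -
  define \<delta> where "\<delta> = min \<delta>\<^sub>1 \<delta>\<^sub>2"
  have \<delta>: "\<delta> > 0" using p q by (simp add: \<delta>_def tame_def)
  have pa: "decays C (p a)" "decays (C * norm a) (\<lambda>x. p a x - p 0 x)"
    and qa: "decays D (q a)" "decays (D * norm a) (\<lambda>x. q a x - q 0 x)" if "norm a < \<delta>" for a
    using p q that by (auto simp: \<delta>_def tame_def)
  have p0: "decays C (p 0)" and q0: "decays D (q 0)" using pa[of 0] qa[of 0] \<delta> by auto
  have Pe: "decays (C * norm e) (\<lambda>x. P x e)" and Re: "decays (D * norm e) (\<lambda>x. R x e)" for e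
    using p q by (auto simp: tame_def)
  have derP: "((\<lambda>a. p a x) has_derivative P x) (at 0)" and derR: "((\<lambda>a. q a x) has_derivative R x) (at 0)" for x
    using p q by (auto simp: tame_def)
  have linP: "linear (P x)" and linR: "linear (R x)" for x
    using derP derR by (auto intro: has_derivative_linear)
  define G where "G = (\<lambda>a. integrand (p a) (q a) v)"
  define D' where "D' = (\<lambda>e z. integrand (\<lambda>x. P x e) (q 0) v z + integrand (p 0) (\<lambda>x. R x e) v z)"
  have intG: "integrable N (G a)" "Q (p a) (q a) v = (LINT z|N. G a z)" if "norm a < \<delta>" for a
    unfolding G_def using integrable_integrand[OF pa(1) qa(1)] collision_op_eq[OF pa(1) qa(1)] that by auto
  have intD: "integrable N (D' e)"
    and QD: "Q (\<lambda>x. P x e) (q 0) v + Q (p 0) (\<lambda>x. R x e) v = (LINT z|N. D' e z)" for e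
    unfolding D'_def
    by (auto simp: integrable_integrand[OF Pe q0] integrable_integrand[OF p0 Re]
        collision_op_eq[OF Pe q0] collision_op_eq[OF p0 Re])
  have D'_linear: "D' (x + y) = (\<lambda>z. D' x z + D' y z)" "D' (r *\<^sub>R x) = (\<lambda>z. r * D' x z)" for x y r
    unfolding D'_def fun_eq_iff
    by (simp_all add: linear_add[OF linP] linear_add[OF linR] linear_cmul[OF linP] linear_cmul[OF linR]
      integrand_add_left integrand_add_right integrand_scale_left integrand_scale_right algebra_simps)
  have bl: "bounded_linear (\<lambda>e. LINT z|N. D' e z)"
    unfolding linear_conv_bounded_linear[symmetric]
    by (rule linearI) (simp_all add: D'_linear intD)
  have derG: "((\<lambda>a. G a z) has_derivative (\<lambda>e. D' e z)) (at 0)" for z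
    unfolding G_def D'_def integrand_def
    by (rule derivative_eq_intros derP derR refl)+ (auto simp: algebra_simps)
  obtain A where A: "0 \<le> A" and bound: "\<And>p q C D. decays C p \<Longrightarrow> decays D q \<Longrightarrow>
      AE z in N. \<bar>integrand p q v z\<bar> \<le> A * C * D * weight v (fst z)"
    by (rule integrand_bound[of v]) blast
  define h where "h = (\<lambda>a z. (G a z - G 0 z - D' a z) / norm a)"
  have h_bound: "AE z in N. norm (h a z) \<le> 4 * (A * C * D) * weight v (fst z)"
    if a: "norm a < \<delta>" "a \<noteq> 0" for a
  proof -
    have "h a z = (integrand (\<lambda>x. p a x - p 0 x) (q a) v z + integrand (p 0) (\<lambda>x. q a x - q 0 x) v z - D' a z) / norm a" for z
      by (simp add: h_def G_def integrand_diff_left integrand_diff_right)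
    note h = this[unfolded D'_def]
    show ?thesis
      using bound[OF pa(2)[OF a(1)] qa(1)[OF a(1)]] bound[OF p0 qa(2)[OF a(1)]]
        bound[OF Pe q0, of a] bound[OF p0 Re, of a]
    proof eventually_elim
      case (elim z)
      have "\<bar>integrand (\<lambda>x. p a x - p 0 x) (q a) v z + integrand (p 0) (\<lambda>x. q a x - q 0 x) v z
          - (integrand (\<lambda>x. P x a) (q 0) v z + integrand (p 0) (\<lambda>x. R x a) v z)\<bar>
        \<le> 4 * (A * C * D) * weight v (fst z) * norm a"
        using elim by (simp add: mult_ac) 
      then show ?case using a unfolding h by (simp add: divide_simps)
    qed
  qed
  have lim: "((\<lambda>a. LINT z|N. h a z) \<longlongrightarrow> 0) (at 0)"
    unfolding tendsto_at_iff_sequentially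
  proof (intro allI impI)
    fix X :: "nat \<Rightarrow> 'e" assume X: "\<forall>i. X i \<in> UNIV - {0}" and lX: "X \<longlonglongrightarrow> 0"
    \<comment> \<open>The domination holds for small parameters only, so a tail of the sequence is used.\<close>
    obtain n0 where n0: "\<And>n. n \<ge> n0 \<Longrightarrow> norm (X n) < \<delta>"
      using LIMSEQ_D[OF lX \<delta>] by auto
    have "(\<lambda>n. LINT z|N. h (X (n + n0)) z) \<longlonglongrightarrow> (LINT z|N. 0)"
    proof (rule integral_dominated_convergence)
      show "integrable N (\<lambda>z. 4 * (A * C * D) * weight v (fst z))"
        by (intro integrable_mult_right integrable_weight_N)
      show "h (X (n + n0)) \<in> borel_measurable N" for n
        unfolding h_def
        using intG(1)[of "X (n + n0)"] intG(1)[of 0] intD \<delta> n0[of "n + n0"]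
        by (intro borel_measurable_divide borel_measurable_diff borel_measurable_integrable) auto
      show "AE z in N. norm (h (X (n + n0)) z) \<le> 4 * (A * C * D) * weight v (fst z)" for n
        by (rule h_bound) (use X n0 in auto)
      show "AE z in N. (\<lambda>n. h (X (n + n0)) z) \<longlonglongrightarrow> 0"
      proof (rule AE_I2)
        fix z
        have "((\<lambda>y. (G y z - G 0 z - D' y z) / norm y) \<longlongrightarrow> 0) (at 0)"
          using derG[of z] unfolding has_derivative_at2 by (simp add: divide_inverse mult.commute diff_diff_eq)
        then have "(\<lambda>n. h (X n) z) \<longlonglongrightarrow> 0"
          unfolding tendsto_at_iff_sequentially using X lX by (auto simp: h_def o_def)
        then show "(\<lambda>n. h (X (n + n0)) z) \<longlonglongrightarrow> 0" by (rule LIMSEQ_ignore_initial_segment)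
      qed
    qed simp
    then show "((\<lambda>a. LINT z|N. h a z) \<circ> X) \<longlonglongrightarrow> 0"
      by (simp add: o_def LIMSEQ_offset[of _ n0])
  qed
  have "((\<lambda>a. LINT z|N. G a z) has_derivative (\<lambda>e. LINT z|N. D' e z)) (at 0)"
    unfolding has_derivative_at2
  proof (intro conjI bl)
    have "\<forall>\<^sub>F a in at 0. (LINT z|N. h a z) =
        (1 / norm (a - 0)) *\<^sub>R ((LINT z|N. G a z) - ((LINT z|N. G 0 z) + (LINT z|N. D' (a - 0) z)))"
      unfolding eventually_at
      by (rule exI[of _ \<delta>])
        (use \<delta> intG(1)[of 0] in \<open>auto simp: h_def intG(1) intD\<close>)
    from tendsto_cong[THEN iffD1, OF this lim]
    show "(\<lambda>y. (1 / norm (y - 0)) *\<^sub>R ((LINT z|N. G y z) - ((LINT z|N. G 0 z) + (LINT z|N. D' (y - 0) z))))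
        \<midarrow>0\<rightarrow> 0" .
  qed
  then show ?thesis
    unfolding QD
    by (rule has_derivative_transform_within[where d = \<delta>]) (use \<delta> intG(2) in auto)
qed

end

section \<open>Boosts and rotations as flows\<close>

lemma partial_eq_derivative:
  assumes "(F has_derivative F') (at x)" shows "partial j F x = F' (axis j 1)"
proof -
  have lin: "linear F'" using assms by (rule has_derivative_linear)
  have "((\<lambda>t. F (x + t *\<^sub>R axis j 1)) has_derivative (\<lambda>t. F' (t *\<^sub>R axis j 1))) (at 0)"
    by (rule has_derivative_compose[where f="\<lambda>t. x + t *\<^sub>R axis j 1" and g=F])
      (auto intro!: derivative_eq_intros simp: assms)
  then have "((\<lambda>t. F (x + t *\<^sub>R axis j 1)) has_field_derivative F' (axis j 1)) (at 0)"
    by (simp add: has_field_derivative_def linear_cmul[OF lin] mult.commute[of _ "F' (axis j 1)"])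
  then show ?thesis unfolding partial_def by (rule DERIV_imp_deriv)
qed

lemma smooth_has_derivative:
  assumes "smooth F"
  shows "(F has_derivative (\<lambda>e. \<Sum>j\<in>UNIV. e $ j * partial j F x)) (at x)"
    and "continuous_on UNIV F" and "continuous_on UNIV (partial j F)"
proof -
  have d: "F differentiable_on UNIV" "partial j F differentiable_on UNIV" for j
    using assms unfolding smooth_def by (auto dest: spec[of _ "[]"] spec[of _ "[j]"])
  then show "continuous_on UNIV F" "continuous_on UNIV (partial j F)"
    by (auto intro: differentiable_imp_continuous_on)
  obtain F' where F': "(F has_derivative F') (at x)"
    using d(1) by (auto simp: differentiable_on_def differentiable_def)
  have lin: "linear F'" using F' by (rule has_derivative_linear)
  have "F' e = (\<Sum>j\<in>UNIV. e $ j * partial j F x)" for e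
  proof -
    have "F' e = F' (\<Sum>j\<in>UNIV. (e $ j) *s axis j 1)" by (simp only: basis_expansion)
    also have "\<dots> = (\<Sum>j\<in>UNIV. e $ j * F' (axis j 1))"
      by (simp only: linear_sum[OF lin] scalar_mult_eq_scaleR linear_cmul[OF lin] real_scaleR_def)
    finally show ?thesis by (simp only: partial_eq_derivative[OF F'])
  qed
  then have "F' = (\<lambda>e. \<Sum>j\<in>UNIV. e $ j * partial j F x)" by (rule ext)
  then show "(F has_derivative (\<lambda>e. \<Sum>j\<in>UNIV. e $ j * partial j F x)) (at x)"
    using F' by (simp only:)
qed

text \<open>A family of transformations that is the identity at parameter \<open>0\<close>, with velocity \<open>X\<close> there; the
  displacement may grow linearly in \<open>norm x\<close>, as it does for boosts and rotations.\<close>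

definition near_identity_flow ::
  "('e::real_normed_vector \<Rightarrow> real^3 \<Rightarrow> real^3) \<Rightarrow> (real^3 \<Rightarrow> 'e \<Rightarrow> real^3) \<Rightarrow> real \<Rightarrow> real \<Rightarrow> bool" where
  "near_identity_flow \<phi> X \<delta> B \<longleftrightarrow> \<delta> > 0 \<and> B > 0 \<and> (\<forall>x. \<phi> 0 x = x) \<and>
    (\<forall>a. norm a < \<delta> \<longrightarrow> \<phi> a \<in> borel_measurable borel \<and> (\<forall>x. norm (\<phi> a x - x) \<le> B * norm a * (1 + norm x))) \<and>
    (\<forall>e. (\<lambda>x. X x e) \<in> borel_measurable borel \<and> (\<forall>x. norm (X x e) \<le> B * norm e * (1 + norm x))) \<and>
    (\<forall>x. ((\<lambda>a. \<phi> a x) has_derivative X x) (at 0))"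

text \<open>The linear growth of the displacement costs one power of \<open>1 + norm x\<close>, and the derivatives of
  \<open>f\<close> decay one power faster than \<open>f\<close>. For small parameters the segment from \<open>x\<close> to \<open>\<phi> a x\<close> stays where
  \<open>1 + norm\<close> is at least half of its value at \<open>x\<close>, so the decay along the segment is comparable to that at \<open>x\<close>.\<close>

lemma flow_tame:
  fixes f :: "real^3 \<Rightarrow> real"
  assumes flow: "near_identity_flow \<phi> X \<delta> B" and f: "smooth f" "sufficient_decay f"
  obtains \<delta>' C where "tame (\<lambda>a x. f (\<phi> a x)) (\<lambda>x e. \<Sum>j\<in>UNIV. X x e $ j * partial j f x) \<delta>' C"
proof -
  define f' where "f' = (\<lambda>x e. \<Sum>j\<in>UNIV. e $ j * partial j f x)"
  have der: "(f has_derivative f' x) (at x)" for x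
    unfolding f'_def by (rule smooth_has_derivative(1)[OF f(1)])
  obtain C where C: "\<And>v. \<bar>f v\<bar> \<le> C / (1 + norm v) ^ 3" "\<And>j v. \<bar>partial j f v\<bar> \<le> C / (1 + norm v) ^ 4"
    using f(2) unfolding sufficient_decay_def by blast
  have C0: "0 \<le> C" using C(1)[of 0] by simp
  have [measurable]: "f \<in> borel_measurable borel" "partial j f \<in> borel_measurable borel" for j
    using smooth_has_derivative[OF f(1)] by (auto intro: borel_measurable_continuous_onI)
  have f'_bound: "\<bar>f' x e\<bar> \<le> 3 * C / (1 + norm x) ^ 4 * norm e" for x e
  proof -
    have "\<bar>f' x e\<bar> \<le> (\<Sum>j\<in>UNIV. \<bar>e $ j * partial j f x\<bar>)" unfolding f'_def by (rule sum_abs)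
    also have "\<dots> \<le> (\<Sum>j\<in>(UNIV::3 set). norm e * (C / (1 + norm x) ^ 4))"
      unfolding abs_mult using C C0 component_le_norm_cart[of e] by (intro sum_mono mult_mono) auto
    finally show ?thesis by (simp add: mult_ac)
  qed
  have \<delta>B: "\<delta> > 0" "B > 0" and \<phi>0: "\<And>x. \<phi> 0 x = x"
    and \<phi>: "\<And>a. norm a < \<delta> \<Longrightarrow> \<phi> a \<in> borel_measurable borel"
      "\<And>a x. norm a < \<delta> \<Longrightarrow> norm (\<phi> a x - x) \<le> B * norm a * (1 + norm x)"
    and X: "\<And>e. (\<lambda>x. X x e) \<in> borel_measurable borel" "\<And>x e. norm (X x e) \<le> B * norm e * (1 + norm x)"
    and der\<phi>: "\<And>x. ((\<lambda>a. \<phi> a x) has_derivative X x) (at 0)"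
    using flow unfolding near_identity_flow_def by auto
  \<comment> \<open>The second bound makes the displacement of \<open>x\<close> at most half of \<open>1 + norm x\<close>.\<close>
  define \<delta>' where "\<delta>' = min \<delta> (1 / (2 * B))"
  \<comment> \<open>\<open>8\<close> and \<open>16\<close> are the losses \<open>2 ^ 3\<close> and \<open>2 ^ 4\<close> of decay along the segment; \<open>48 = 16 * 3\<close> with \<open>3\<close> partial derivatives.\<close>
  define D where "D = 8 * C + 48 * C * B"
  have near: "norm (\<phi> a x - x) \<le> (1 + norm x) / 2" if "norm a < \<delta>'" for a x
  proof -
    have "B * norm a \<le> 1 / 2" using that \<delta>B by (simp add: \<delta>'_def field_simps)
    then have "B * norm a * (1 + norm x) \<le> 1 / 2 * (1 + norm x)" by (intro mult_right_mono) auto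
    then show ?thesis using \<phi>(2)[of a x] that by (simp add: \<delta>'_def)
  qed
  have half: "(1 + norm x) / 2 \<le> 1 + norm y" if "norm (y - x) \<le> (1 + norm x) / 2" for x y :: "real^3"
    using that norm_triangle_ineq2[of x y] norm_minus_commute[of x y] by argo
  have pw: "E / (1 + norm y) ^ n \<le> 2 ^ n * E / (1 + norm x) ^ n" if "norm (y - x) \<le> (1 + norm x) / 2" "0 \<le> E"
    for x y :: "real^3" and E :: real and n
  proof -
    have "1 + norm x \<le> 2 * (1 + norm y)" using half[OF that(1)] by argo
    then have "(1 + norm x) ^ n \<le> (2 * (1 + norm y)) ^ n" by (rule power_mono) simp
    then have "(1 + norm x) ^ n \<le> 2 ^ n * (1 + norm y) ^ n" by (simp only: power_mult_distrib)
    then have "E * (1 + norm x) ^ n \<le> E * (2 ^ n * (1 + norm y) ^ n)"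
      using that(2) by (rule mult_left_mono)
    then show ?thesis by (simp add: divide_simps add_pos_nonneg mult_ac)
  qed
  have p4: "r / (1 + norm x) ^ 4 * (1 + norm x) = r / (1 + norm x) ^ 3" for x :: "real^3" and r
  proof -
    have "1 + norm x \<noteq> 0" using norm_ge_zero[of x] by argo
    moreover have "(1 + norm x) ^ 4 = (1 + norm x) ^ 3 * (1 + norm x)" by (simp add: eval_nat_numeral)
    ultimately show ?thesis by simp
  qed
  have "tame (\<lambda>a x. f (\<phi> a x)) (\<lambda>x e. f' x (X x e)) \<delta>' D"
    unfolding tame_def
  proof (intro conjI allI impI)
    show "\<delta>' > 0" using \<delta>B by (simp add: \<delta>'_def)
    fix x show "((\<lambda>a. f (\<phi> a x)) has_derivative (\<lambda>e. f' x (X x e))) (at 0)"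
      using has_derivative_compose[OF der\<phi>[of x], of f "f' x"] der \<phi>0 by simp
  next
    fix a :: 'a assume a: "norm a < \<delta>'"
    have [measurable]: "\<phi> a \<in> borel_measurable borel" using \<phi>(1)[of a] a by (simp add: \<delta>'_def)
    show "decays D (\<lambda>x. f (\<phi> a x))"
      unfolding decays_def
    proof (intro conjI allI)
      fix x
      have "\<bar>f (\<phi> a x)\<bar> \<le> C / (1 + norm (\<phi> a x)) ^ 3" by (rule C)
      also have "\<dots> \<le> 2 ^ 3 * C / (1 + norm x) ^ 3" by (rule pw[OF near[OF a] C0])
      also have "\<dots> \<le> D / (1 + norm x) ^ 3"
        using C0 \<delta>B by (intro divide_right_mono) (auto simp: D_def)
      finally show "\<bar>f (\<phi> a x)\<bar> \<le> D / (1 + norm x) ^ 3" .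
    qed measurable
    show "decays (D * norm a) (\<lambda>x. f (\<phi> a x) - f (\<phi> 0 x))"
      unfolding decays_def \<phi>0
    proof (intro conjI allI)
      fix x
      define y where "y = \<phi> a x - x"
      have "norm (f (x + y) - f x) \<le> norm y * (16 * (3 * C) / (1 + norm x) ^ 4)"
      \<comment> \<open>Mean value inequality on the segment from \<open>x\<close> to \<open>\<phi> a x\<close>.\<close>
      proof (rule differentiable_bound_segment[where G=UNIV and f'=f'])
        show "(f has_derivative f' z) (at z within UNIV)" for z using der by simp
        fix t :: real assume t: "t \<in> {0..1}"
        have "norm ((x + t *\<^sub>R y) - x) \<le> 1 * norm y"
          using t by (simp add: mult_left_le_one_le)
        then have "norm ((x + t *\<^sub>R y) - x) \<le> (1 + norm x) / 2" using near[OF a, of x] by (simp add: y_def)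
        from pw[OF this, of "3 * C" 4] C0
        have "3 * C / (1 + norm (x + t *\<^sub>R y)) ^ 4 \<le> 16 * (3 * C) / (1 + norm x) ^ 4" by simp
        then have "norm (f' (x + t *\<^sub>R y) e) \<le> 16 * (3 * C) / (1 + norm x) ^ 4 * norm e" for e
          unfolding real_norm_def
          by (rule order_trans[OF f'_bound mult_right_mono[OF _ norm_ge_zero]])
        then show "onorm (f' (x + t *\<^sub>R y)) \<le> 16 * (3 * C) / (1 + norm x) ^ 4"
          by (rule onorm_le)
      qed auto
      also have "\<dots> \<le> (B * norm a * (1 + norm x)) * (16 * (3 * C) / (1 + norm x) ^ 4)"
        using \<phi>(2)[of a x] a C0 by (intro mult_right_mono) (auto simp: y_def \<delta>'_def)
      also have "\<dots> = (48 * C * B * norm a) / (1 + norm x) ^ 4 * (1 + norm x)" by simp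
      also have "\<dots> = 48 * C * B * norm a / (1 + norm x) ^ 3" by (rule p4)
      also have "\<dots> \<le> D * norm a / (1 + norm x) ^ 3"
        using C0 \<delta>B by (intro divide_right_mono mult_right_mono) (auto simp: D_def)
      finally show "\<bar>f (\<phi> a x) - f x\<bar> \<le> D * norm a / (1 + norm x) ^ 3" by (simp add: y_def)
    qed measurable
  next
    fix e
    have [measurable]: "(\<lambda>x. X x e $ k) \<in> borel_measurable borel" for k
      by (rule measurable_compose[OF X(1)]) measurable
    show "decays (D * norm e) (\<lambda>x. f' x (X x e))"
      unfolding decays_def
    proof (intro conjI allI)
      show "(\<lambda>x. f' x (X x e)) \<in> borel_measurable borel" unfolding f'_def by measurable
      fix x
      have "\<bar>f' x (X x e)\<bar> \<le> 3 * C / (1 + norm x) ^ 4 * norm (X x e)" by (rule f'_bound)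
      also have "\<dots> \<le> 3 * C / (1 + norm x) ^ 4 * (B * norm e * (1 + norm x))"
        using X C0 by (intro mult_left_mono) auto
      also have "\<dots> = (3 * C * B * norm e) / (1 + norm x) ^ 4 * (1 + norm x)" by simp
      also have "\<dots> = 3 * C * B * norm e / (1 + norm x) ^ 3" by (rule p4)
      also have "\<dots> \<le> D * norm e / (1 + norm x) ^ 3"
        using C0 \<delta>B by (intro divide_right_mono mult_right_mono) (auto simp: D_def)
      finally show "\<bar>f' x (X x e)\<bar> \<le> D * norm e / (1 + norm x) ^ 3" .
    qed
  qed
  then show thesis using that unfolding f'_def by blast
qed

lemma boost_flow:
  assumes c: "c \<ge> 1"
  shows "near_identity_flow (\<lambda>\<beta>. act c (boost \<beta>)) (\<lambda>x e. (2 * energy c x) *\<^sub>R e) (1/2) (6 * c)"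
  unfolding near_identity_flow_def
proof (intro conjI allI impI)
  show "act c (boost 0) x = x" for x by (simp add: act_boost)
  fix \<beta> :: "real^3" assume \<beta>: "norm \<beta> < 1/2"
  show "norm (act c (boost \<beta>) x - x) \<le> 6 * c * norm \<beta> * (1 + norm x)" for x
  proof -
    have "\<beta> \<bullet> \<beta> = norm \<beta> * norm \<beta>" by (simp add: power2_norm_eq_inner[symmetric] power2_eq_square)
    also have "\<dots> \<le> (1/2) * (1/2)" using \<beta> by (intro mult_mono) auto
    finally have q: "3/4 \<le> 1 - \<beta> \<bullet> \<beta>" by simp
    have "\<bar>\<beta> \<bullet> x\<bar> \<le> norm \<beta> * norm x" by (rule Cauchy_Schwarz_ineq2)
    also have "\<dots> \<le> (1/2) * norm x" using \<beta> by (intro mult_right_mono) auto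
    also have "\<dots> \<le> (1/2) * (c * (1 + norm x))"
      using c mult_mono[of 1 c "norm x" "1 + norm x"] by simp
    finally have "\<bar>energy c x + \<beta> \<bullet> x\<bar> \<le> 3/2 * (c * (1 + norm x))"
      using energy_upper[OF c, of x] energy_lower(2)[OF c, of x]
        abs_triangle_ineq[of "energy c x" "\<beta> \<bullet> x"] by argo
    then have "\<bar>2 * (energy c x + \<beta> \<bullet> x)\<bar> \<le> 3 * (c * (1 + norm x))" by (simp only: abs_mult) simp
    then have "\<bar>2 * (energy c x + \<beta> \<bullet> x) / (1 - \<beta> \<bullet> \<beta>)\<bar> \<le> (3 * (c * (1 + norm x))) / (3/4)"
      unfolding abs_divide using q c by (intro frac_le) auto
    also have "\<dots> \<le> 6 * (c * (1 + norm x))" using c by simp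
    finally have "\<bar>2 * (energy c x + \<beta> \<bullet> x) / (1 - \<beta> \<bullet> \<beta>)\<bar> * norm \<beta> \<le> 6 * (c * (1 + norm x)) * norm \<beta>"
      by (intro mult_right_mono) auto
    then show ?thesis by (simp add: act_boost mult_ac)
  qed
next
  fix e x :: "real^3"
  have "0 \<le> c * (1 + norm x)" using c by simp
  then have "2 * energy c x \<le> 6 * (c * (1 + norm x))" using energy_upper[OF c, of x] by argo
  then have "2 * energy c x * norm e \<le> 6 * (c * (1 + norm x)) * norm e"
    by (intro mult_right_mono) auto
  then show "norm ((2 * energy c x) *\<^sub>R e) \<le> 6 * c * norm e * (1 + norm x)"
    using energy_lower(2)[OF c, of x] by (simp add: mult_ac)
next
  fix x :: "real^3"
  show "((\<lambda>\<beta>. act c (boost \<beta>) x) has_derivative (\<lambda>e. (2 * energy c x) *\<^sub>R e)) (at 0)"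
    unfolding act_boost by (rule derivative_eq_intros refl | simp)+
qed (use c in auto)

definition plane_rotation :: "3 \<Rightarrow> 3 \<Rightarrow> real \<Rightarrow> real^3 \<Rightarrow> real^3" where
  "plane_rotation i j t x = x
     + ((cos t - 1) * x $ i + sin t * x $ j) *\<^sub>R axis i 1
     + ((cos t - 1) * x $ j - sin t * x $ i) *\<^sub>R axis j 1"

lemma orthogonal_plane_rotation:
  assumes "i \<noteq> j" shows "orthogonal_transformation (plane_rotation i j t)"
  unfolding orthogonal_transformation
proof
  show "linear (plane_rotation i j t)"
    by (rule linearI) (simp_all add: plane_rotation_def algebra_simps)
  show "\<forall>x. norm (plane_rotation i j t x) = norm x"
  proof
    fix x
    define a where "a = (cos t - 1) * x $ i + sin t * x $ j"
    define b where "b = (cos t - 1) * x $ j - sin t * x $ i"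
    have ax: "(axis i 1 :: real^3) $ j = 0" "(axis j 1 :: real^3) $ i = 0"
      using assms by (auto simp: axis_def)
    have "plane_rotation i j t x \<bullet> plane_rotation i j t x = x \<bullet> x + (2 * (a * x $ i + b * x $ j) + a\<^sup>2 + b\<^sup>2)"
      unfolding plane_rotation_def a_def[symmetric] b_def[symmetric]
      by (simp add: inner_add_left inner_add_right ax inner_axis inner_axis' power2_eq_square algebra_simps)
    also have "2 * (a * x $ i + b * x $ j) + a\<^sup>2 + b\<^sup>2 = ((sin t)\<^sup>2 + (cos t)\<^sup>2 - 1) * ((x $ i)\<^sup>2 + (x $ j)\<^sup>2)"
      unfolding a_def b_def by algebra
    finally show "norm (plane_rotation i j t x) = norm x" by (simp add: norm_eq_sqrt_inner)
  qed
qed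

lemma rotation_flow:
  "near_identity_flow (plane_rotation i j)
     (\<lambda>x e. e *\<^sub>R (x $ j *\<^sub>R axis i 1 - x $ i *\<^sub>R axis j 1)) 1 4"
  unfolding near_identity_flow_def
proof (intro conjI allI impI)
  show "plane_rotation i j 0 x = x" for x by (simp add: plane_rotation_def)
  fix t :: real
  show "plane_rotation i j t \<in> borel_measurable borel"
    unfolding plane_rotation_def[abs_def] by measurable
  show "norm (plane_rotation i j t x - x) \<le> 4 * norm t * (1 + norm x)" for x
  proof -
    have s: "\<bar>sin t\<bar> \<le> \<bar>t\<bar>" by (rule abs_sin_x_le_abs_x)
    have c: "\<bar>cos t - 1\<bar> \<le> \<bar>t\<bar>"
    proof -
      have "1 - cos t = 2 * (\<bar>sin (t / 2)\<bar> * \<bar>sin (t / 2)\<bar>)"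
        using cos_double_sin[of "t / 2"] by (simp add: power2_eq_square)
      also have "\<dots> \<le> 2 * (\<bar>t / 2\<bar> * 1)"
        using abs_sin_x_le_abs_x[of "t / 2"] by (intro mult_left_mono mult_mono) auto
      finally have "1 - cos t \<le> \<bar>t\<bar>" by simp
      then show ?thesis using cos_le_one[of t] by argo
    qed
    have n: "\<bar>x $ k\<bar> \<le> norm x" for k by (rule component_le_norm_cart)
    have m: "\<bar>(cos t - 1) * x $ k\<bar> \<le> \<bar>t\<bar> * norm x" "\<bar>sin t * x $ k\<bar> \<le> \<bar>t\<bar> * norm x" for k
      unfolding abs_mult by (intro mult_mono s c n abs_ge_zero)+
    have 1: "\<bar>(cos t - 1) * x $ i + sin t * x $ j\<bar> \<le> \<bar>t\<bar> * norm x + \<bar>t\<bar> * norm x"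
      by (intro order_trans[OF abs_triangle_ineq] add_mono m)
    have 2: "\<bar>(cos t - 1) * x $ j - sin t * x $ i\<bar> \<le> \<bar>t\<bar> * norm x + \<bar>t\<bar> * norm x"
      by (intro order_trans[OF abs_triangle_ineq4] add_mono m)
    have "norm (plane_rotation i j t x - x) \<le>
        \<bar>(cos t - 1) * x $ i + sin t * x $ j\<bar> + \<bar>(cos t - 1) * x $ j - sin t * x $ i\<bar>"
      unfolding plane_rotation_def
      using norm_triangle_ineq[of "((cos t - 1) * x $ i + sin t * x $ j) *\<^sub>R (axis i 1 :: real^3)"
          "((cos t - 1) * x $ j - sin t * x $ i) *\<^sub>R axis j 1"] by simp
    also have "\<dots> \<le> 4 * \<bar>t\<bar> * norm x" using 1 2 by simp
    also have "\<dots> \<le> 4 * \<bar>t\<bar> * (1 + norm x)" by (intro mult_left_mono) auto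
    finally show ?thesis by simp
  qed
next
  fix e :: real and x :: "real^3"
  have "norm (x $ j *\<^sub>R axis i 1 - x $ i *\<^sub>R (axis j 1 :: real^3)) \<le> \<bar>x $ j\<bar> + \<bar>x $ i\<bar>"
    using norm_triangle_ineq4[of "x $ j *\<^sub>R (axis i 1 :: real^3)" "x $ i *\<^sub>R axis j 1"] by simp
  also have "\<dots> \<le> 4 * (1 + norm x)"
    using component_le_norm_cart[of x i] component_le_norm_cart[of x j] norm_ge_zero[of x] by argo
  finally have "\<bar>e\<bar> * norm (x $ j *\<^sub>R axis i 1 - x $ i *\<^sub>R (axis j 1 :: real^3)) \<le> \<bar>e\<bar> * (4 * (1 + norm x))"
    by (intro mult_left_mono) auto
  then show "norm (e *\<^sub>R (x $ j *\<^sub>R axis i 1 - x $ i *\<^sub>R (axis j 1 :: real^3))) \<le> 4 * norm e * (1 + norm x)"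
    by (simp add: mult_ac)
next
  fix x :: "real^3"
  show "((\<lambda>t. plane_rotation i j t x) has_derivative
      (\<lambda>e. e *\<^sub>R (x $ j *\<^sub>R axis i 1 - x $ i *\<^sub>R axis j 1))) (at 0)"
    unfolding plane_rotation_def
    by (rule derivative_eq_intros refl | simp add: algebra_simps)+
next
  fix e :: real
  show "(\<lambda>x::real^3. e *\<^sub>R (x $ j *\<^sub>R axis i 1 - x $ i *\<^sub>R axis j 1 :: real^3)) \<in> borel_measurable borel"
    by measurable
qed simp_all

section \<open>The differential identities\<close>

context relativistic_collision begin

lemma flow_derivative:
  fixes \<phi> :: "'e::euclidean_space \<Rightarrow> real^3 \<Rightarrow> real^3"
  assumes flow: "near_identity_flow \<phi> X \<delta> B"
    and f: "smooth f" "sufficient_decay f" and h: "smooth h" "sufficient_decay h"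
  shows "((\<lambda>a. Q (\<lambda>x. h (\<phi> a x)) (\<lambda>x. f (\<phi> a x)) v) has_derivative
     (\<lambda>e. Q (\<lambda>x. \<Sum>k\<in>UNIV. X x e $ k * partial k h x) f v
        + Q h (\<lambda>x. \<Sum>k\<in>UNIV. X x e $ k * partial k f x) v)) (at 0)"
proof -
  obtain \<delta>1 C where 1: "tame (\<lambda>a x. h (\<phi> a x)) (\<lambda>x e. \<Sum>k\<in>UNIV. X x e $ k * partial k h x) \<delta>1 C"
    by (rule flow_tame[OF flow h])
  obtain \<delta>2 D where 2: "tame (\<lambda>a x. f (\<phi> a x)) (\<lambda>x e. \<Sum>k\<in>UNIV. X x e $ k * partial k f x) \<delta>2 D"
    by (rule flow_tame[OF flow f])
  have "\<phi> 0 x = x" for x using flow by (simp add: near_identity_flow_def)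
  then show ?thesis using collision_op_has_derivative[OF 1 2, of v] by simp
qed

lemma sum_axis_component: "(\<Sum>k\<in>UNIV. (r *\<^sub>R axis j (1::real) :: real^3) $ k * F k) = r * F j"
proof -
  have "(\<Sum>k\<in>UNIV. (r *\<^sub>R axis j (1::real) :: real^3) $ k * F k) = (\<Sum>k\<in>UNIV. if k = j then r * F j else 0)"
    by (rule sum.cong) (auto simp: axis_def)
  then show ?thesis by simp
qed

text \<open>Boosting \<open>v\<close> to \<open>y\<close> by \<open>\<psi> y\<close> expresses \<open>Q h f y\<close> as \<open>energy c v / energy c y\<close> times a collision
  integral at the fixed point \<open>v\<close>, with \<open>\<psi> y\<close> as parameter inside the functions. The term with
  \<open>v $ j / energy c v\<close> is the derivative of the prefactor. The velocity of the boosts at parameter \<open>0\<close> is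
  \<open>2 * energy c x\<close> times the direction, and the derivative of \<open>\<psi>\<close> at \<open>v\<close> is division by
  \<open>2 * energy c v\<close>.\<close>

theorem collision_op_differentiable:
  assumes f: "smooth f" "sufficient_decay f" and h: "smooth h" "sufficient_decay h"
  shows "Q h f differentiable (at v)"
    and "energy c v * partial j (Q h f) v =
        Q h (\<lambda>w. energy c w * partial j f w) v + Q (\<lambda>w. energy c w * partial j h w) f v
        - v $ j / energy c v * Q h f v"
proof -
  have [measurable]: "f \<in> borel_measurable borel" "h \<in> borel_measurable borel"
    using smooth_has_derivative(2) f(1) h(1) by (auto intro: borel_measurable_continuous_onI)
  have E: "energy c x > 0" for x by (rule energy_pos[OF c_pos])
  define \<phi> where "\<phi> = (\<lambda>\<beta>. act c (boost \<beta>))"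
  define G where "G = (\<lambda>\<beta>. Q (\<lambda>x. h (\<phi> \<beta> x)) (\<lambda>x. f (\<phi> \<beta> x)) v)"
  define G' where "G' = (\<lambda>e. Q (\<lambda>x. \<Sum>k\<in>UNIV. ((2 * energy c x) *\<^sub>R e) $ k * partial k h x) f v
        + Q h (\<lambda>x. \<Sum>k\<in>UNIV. ((2 * energy c x) *\<^sub>R e) $ k * partial k f x) v)"
  have derG: "(G has_derivative G') (at 0)"
    unfolding G_def G'_def \<phi>_def by (rule flow_derivative[OF boost_flow[OF c] f h])
  have linG': "linear G'" using derG by (rule has_derivative_linear)
  have G0: "G 0 = Q h f v" by (simp add: G_def \<phi>_def act_boost)
  define \<psi> where "\<psi> = (\<lambda>y. (y - v) /\<^sub>R (energy c y + energy c v))"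
  have \<psi>0: "\<psi> v = 0" by (simp add: \<psi>_def)
  have der\<psi>: "(\<psi> has_derivative (\<lambda>e. e /\<^sub>R (2 * energy c v))) (at v)"
    unfolding \<psi>_def using E[of v]
    by (auto intro!: derivative_eq_intros has_derivative_energy[OF c_pos])
  have reach: "norm (\<psi> y) < 1" "\<phi> (\<psi> y) v = y" for y
  proof -
    have eq: "\<psi> y = (snd (shell c y) - snd (shell c v)) /\<^sub>R (fst (shell c y) + fst (shell c v))"
      by (simp add: \<psi>_def shell_def)
    note b = boost_between[OF future_shell[OF c_pos] future_shell[OF c_pos] _ eq]
    show "norm (\<psi> y) < 1" using b(1) by (simp add: mink_shell_self)
    have "boost (\<psi> y) (shell c v) = shell c y" using b(2) by (simp add: mink_shell_self)
    then show "\<phi> (\<psi> y) v = y" by (simp add: \<phi>_def act_def) (simp add: shell_def)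
  qed
  have eq: "Q h f = (\<lambda>y. energy c v * G (\<psi> y) / energy c y)"
  proof
    fix y
    have "energy c (\<phi> (\<psi> y) v) * Q h f (\<phi> (\<psi> y) v) = energy c v * G (\<psi> y)"
      unfolding G_def \<phi>_def
      by (rule collision_op_covariance[OF lorentz_boost[OF reach(1)]]) measurable
    then show "Q h f y = energy c v * G (\<psi> y) / energy c y" using E[of y] by (simp add: reach field_simps)
  qed
  have derG\<psi>: "((\<lambda>y. G (\<psi> y)) has_derivative (\<lambda>e. G' (e /\<^sub>R (2 * energy c v)))) (at v)"
    using has_derivative_compose[OF der\<psi>, of G G'] derG by (simp add: \<psi>0)
  have der: "(Q h f has_derivative
      (\<lambda>e. G' (e /\<^sub>R (2 * energy c v)) - (v \<bullet> e / energy c v) * Q h f v / energy c v)) (at v)"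
    unfolding eq
    by (rule derivative_eq_intros derG\<psi> has_derivative_energy[OF c_pos] refl)+
      (use E[of v] in \<open>auto simp: \<psi>0 G0 field_simps\<close>)
  then show "Q h f differentiable (at v)" by (auto simp: differentiable_def)
  have G'j: "G' (axis j 1) = 2 * (Q h (\<lambda>w. energy c w * partial j f w) v + Q (\<lambda>w. energy c w * partial j h w) f v)"
  proof -
    have "G' ((1/2) *\<^sub>R axis j 1) = Q (\<lambda>w. energy c w * partial j h w) f v + Q h (\<lambda>w. energy c w * partial j f w) v"
      unfolding G'_def scaleR_scaleR sum_axis_component by simp
    then show ?thesis by (simp add: linear_cmul[OF linG'])
  qed
  have step: "G' (axis j 1 /\<^sub>R (2 * energy c v)) =
      (Q h (\<lambda>w. energy c w * partial j f w) v + Q (\<lambda>w. energy c w * partial j h w) f v) / energy c v"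
    unfolding linear_cmul[OF linG'] G'j using E[of v] by (simp add: divide_simps)
  have "partial j (Q h f) v = G' (axis j 1 /\<^sub>R (2 * energy c v)) - (v \<bullet> axis j 1 / energy c v) * Q h f v / energy c v"
    by (rule partial_eq_derivative[OF der])
  also have "v \<bullet> axis j 1 = v $ j" by (simp add: inner_axis)
  finally have "energy c v * partial j (Q h f) v = energy c v *
      ((Q h (\<lambda>w. energy c w * partial j f w) v + Q (\<lambda>w. energy c w * partial j h w) f v) / energy c v
        - v $ j / energy c v * Q h f v / energy c v)"
    by (simp only: step)
  then show "energy c v * partial j (Q h f) v =
        Q h (\<lambda>w. energy c w * partial j f w) v + Q (\<lambda>w. energy c w * partial j h w) f v
        - v $ j / energy c v * Q h f v"
    using E[of v] by (simp add: right_diff_distrib)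
qed

text \<open>Rotations preserve the energy, so the collision operator commutes with them; differentiating
  along a rotation in the plane of the axes \<open>i\<close> and \<open>j\<close> gives the identity. The left-hand side is
  computed by the chain rule, which uses the differentiability proved before.\<close>

theorem collision_op_rotation_derivative:
  assumes f: "smooth f" "sufficient_decay f" and h: "smooth h" "sufficient_decay h" and ij: "i \<noteq> j"
  shows "v $ j * partial i (Q h f) v - v $ i * partial j (Q h f) v =
        Q h (\<lambda>w. w $ j * partial i f w - w $ i * partial j f w) v
        + Q (\<lambda>w. w $ j * partial i h w - w $ i * partial j h w) f v"
proof -
  have [measurable]: "f \<in> borel_measurable borel" "h \<in> borel_measurable borel"
    using smooth_has_derivative(2) f(1) h(1) by (auto intro: borel_measurable_continuous_onI)
  let ?R = "plane_rotation i j"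
  define X where "X = (\<lambda>x::real^3. x $ j *\<^sub>R axis i 1 - x $ i *\<^sub>R (axis j 1 :: real^3))"
  have XF: "(\<Sum>k\<in>UNIV. X x $ k * F k) = x $ j * F i - x $ i * F j" for x F
    using sum_axis_component[of "x $ j" i F] sum_axis_component[of "x $ i" j F]
    by (simp add: X_def left_diff_distrib sum_subtractf)
  have inv: "Q (\<lambda>x. h (?R t x)) (\<lambda>x. f (?R t x)) v = Q h f (?R t v)" for t
  proof -
    have R: "orthogonal_transformation (?R t)" by (rule orthogonal_plane_rotation[OF ij])
    have "act c (\<lambda>z. (fst z, ?R t (snd z))) x = ?R t x" for x by (simp add: act_def shell_def)
    then show ?thesis
      using collision_op_covariance[OF lorentz_rotation[OF R], of h f v] energy_pos[OF c_pos, of v]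
      by (simp add: energy_rotation[OF R])
  qed
  obtain Q' where Q': "(Q h f has_derivative Q') (at v)"
    using collision_op_differentiable(1)[OF f h] by (auto simp: differentiable_def)
  have linQ': "linear Q'" using Q' by (rule has_derivative_linear)
  have flow: "near_identity_flow ?R (\<lambda>x e. e *\<^sub>R X x) 1 4"
    unfolding X_def by (rule rotation_flow)
  have R0: "?R 0 v = v" and derR: "((\<lambda>t. ?R t v) has_derivative (\<lambda>e. e *\<^sub>R X v)) (at 0)"
    using flow by (auto simp: near_identity_flow_def)
  have 1: "((\<lambda>t. Q h f (?R t v)) has_derivative (\<lambda>e. Q' (e *\<^sub>R X v))) (at 0)"
    using has_derivative_compose[OF derR, of "Q h f" Q'] Q' R0 by simp
  have 2: "((\<lambda>t. Q h f (?R t v)) has_derivative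
     (\<lambda>e. Q (\<lambda>x. \<Sum>k\<in>UNIV. (e *\<^sub>R X x) $ k * partial k h x) f v
        + Q h (\<lambda>x. \<Sum>k\<in>UNIV. (e *\<^sub>R X x) $ k * partial k f x) v)) (at 0)"
    using flow_derivative[OF flow f h, of v] by (simp only: inv)
  have "Q' (1 *\<^sub>R X v) = Q (\<lambda>x. \<Sum>k\<in>UNIV. (1 *\<^sub>R X x) $ k * partial k h x) f v
        + Q h (\<lambda>x. \<Sum>k\<in>UNIV. (1 *\<^sub>R X x) $ k * partial k f x) v"
    using fun_cong[OF has_derivative_unique[OF 1 2], of 1] .
  moreover have "Q' (X v) = v $ j * partial i (Q h f) v - v $ i * partial j (Q h f) v"
    by (simp add: X_def linear_diff[OF linQ'] linear_cmul[OF linQ'] partial_eq_derivative[OF Q'])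
  ultimately show ?thesis by (simp add: XF)
qed

end

theorem theorem5p15:
  fixes c \<gamma> :: real and \<sigma>\<^sub>0 :: "real \<Rightarrow> real" and f h :: "real^3 \<Rightarrow> real" and i j :: 3
  assumes "c \<ge> 1"
    and "-2 < \<gamma>" and "\<gamma> \<le> 0"
    and "\<sigma>\<^sub>0 \<in> borel_measurable (restrict_space borel {0..pi})"
    and "\<exists>M. \<forall>\<theta>\<in>{0..pi}. 0 \<le> \<sigma>\<^sub>0 \<theta> \<and> \<sigma>\<^sub>0 \<theta> \<le> M"
    and "smooth f" and "sufficient_decay f"
    and "smooth h" and "sufficient_decay h"
    and "i \<noteq> j"
  shows "let Q = collision_op c \<gamma> \<sigma>\<^sub>0 in \<forall>v.
      Q h f differentiable (at v) \<and>
      energy c v * partial j (Q h f) v =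
        Q h (\<lambda>w. energy c w * partial j f w) v + Q (\<lambda>w. energy c w * partial j h w) f v
        - v $ j / energy c v * Q h f v \<and>
      v $ j * partial i (Q h f) v - v $ i * partial j (Q h f) v =
        Q h (\<lambda>w. w $ j * partial i f w - w $ i * partial j f w) v
        + Q (\<lambda>w. w $ j * partial i h w - w $ i * partial j h w) f v"
proof -
  obtain M where "\<And>\<theta>. \<theta> \<in> {0..pi} \<Longrightarrow> 0 \<le> \<sigma>\<^sub>0 \<theta> \<and> \<sigma>\<^sub>0 \<theta> \<le> M"
    using assms(5) by blast
  then interpret relativistic_collision c \<gamma> \<sigma>\<^sub>0 M
    using assms by unfold_locales auto
  show ?thesis unfolding Let_def
    using collision_op_differentiable collision_op_rotation_derivative assms(6-10) by blast
qed

end
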